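(* Let $N,n,k,t$ be positive integers satisfying $n\ge 2^{13}k\log_2(2k)$ and $n\ge 2^{19}tk\log_2^2\frac nk$. Let $\mathcal{C}\subset 2^{[N]}$ be a simplicial complex such that every inclusion-maximal set of $\mathcal{C}$ has size at least $n$. If $\mathcal{F}\subset \mathcal{C}^{(k)}$ is $t$-intersecting, then there exists a set $T\subset[N]$ of size $t$ such that $|\mathcal{F}|\le |\mathcal{C}^{(k)}(T)|$. Moreover, if $$m = \min_{T\in {[N]\choose t}} \big|\mathcal{F}\setminus \mathcal{C}^{(k)}[T]\big|,$$ then $$|\mathcal{F}|\le \max\Big\{\max_{T\in {[N]\choose t}}|\mathcal{C}^{(k)}(T)|-m\,2^{2^{-20}\frac n{k\log_2 \frac nk}},\ 0.6\max_{T\in {[N]\choose t}}|\mathcal{C}^{(k)}(T)|\Big\}.$$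
   Context: A simplicial complex (hereditary family) $\mathcal{C}\subset 2^{[N]}$ is a family such that $A\in\mathcal{C}$ and $B\subset A$ imply $B\in\mathcal{C}$. For a family $\mathcal{A}$, $\mathcal{A}^{(k)}$ denotes the subfamily of all $k$-element sets of $\mathcal{A}$. A family $\mathcal{F}$ is $t$-intersecting if $|F_1\cap F_2|\ge t$ for all $F_1,F_2\in\mathcal{F}$. For a set $B$, $\mathcal{A}(B)=\{F\setminus B: F\in\mathcal{A}, B\subset F\}$ and $\mathcal{A}[B]=\{F\in\mathcal{A}: B\subset F\}$ (so $|\mathcal{A}(B)|=|\mathcal{A}[B]|$). *)

theory Defs
  imports Complex_Main "HOL-Library.Ramsey"
begin

definition hereditary :: "'a set set \<Rightarrow> bool" where
  "hereditary \<C> \<longleftrightarrow> (\<forall>A\<in>\<C>. \<forall>B\<subseteq>A. B \<in> \<C>)"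

definition inclusion_maximal :: "'a set set \<Rightarrow> 'a set \<Rightarrow> bool" where
  "inclusion_maximal \<C> M \<longleftrightarrow> M \<in> \<C> \<and> (\<forall>A\<in>\<C>. M \<subseteq> A \<longrightarrow> A = M)"

definition layer :: "'a set set \<Rightarrow> nat \<Rightarrow> 'a set set" where
  "layer \<A> k = {A \<in> \<A>. finite A \<and> card A = k}"

text \<open>Only pairs of finite sets occur below, so \<^const>\<open>card\<close> is the true cardinality.
  The two sets may coincide, hence every member of the family has at least t elements.\<close>

definition t_intersecting :: "nat \<Rightarrow> 'a set set \<Rightarrow> bool" where
  "t_intersecting t \<F> \<longleftrightarrow> (\<forall>F1\<in>\<F>. \<forall>F2\<in>\<F>. t \<le> card (F1 \<inter> F2))"

text \<open>\<open>link \<A> B\<close> is \<open>\<A>(B)\<close> and \<open>star \<A> B\<close> is \<open>\<A>[B]\<close>.\<close>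

definition link :: "'a set set \<Rightarrow> 'a set \<Rightarrow> 'a set set" where
  "link \<A> B = {F - B |F. F \<in> \<A> \<and> B \<subseteq> F}"

definition star :: "'a set set \<Rightarrow> 'a set \<Rightarrow> 'a set set" where
  "star \<A> B = {F \<in> \<A>. B \<subseteq> F}"

text \<open>The ground set is \<open>{1..N}\<close>, and \<^term>\<open>nsets {1..N} t\<close> is the family of its t-element
  subsets. Minima and maxima over this family presuppose that it is nonempty, that is
  \<open>t \<le> N\<close>. The lemma below shows that the size conditions imply this as soon as the complex
  is nonempty; only for the empty family, which is vacuously hereditary, is it a separate
  requirement.\<close>

lemma t_le_N:
  fixes N n k t :: nat and \<C> :: "nat set set"
  assumes "k > 0" "t > 0"
    and n1: "real n \<ge> 2 ^ 13 * real k * log 2 (2 * real k)"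
    and n2: "real n \<ge> 2 ^ 19 * real t * real k * (log 2 (real n / real k))\<^sup>2"
    and C: "\<C> \<subseteq> Pow {1..N}" "\<C> \<noteq> {}"
    and max: "\<And>M. inclusion_maximal \<C> M \<Longrightarrow> n \<le> card M"
  shows "t \<le> N"
proof -
  have "finite \<C>" using C(1) finite_subset by blast
  then obtain M where M: "M \<in> \<C>" "\<And>A. A \<in> \<C> \<Longrightarrow> M \<subseteq> A \<Longrightarrow> A = M"
    using finite_has_maximal[of \<C>] C(2) by metis
  have "n \<le> card M" using max M unfolding inclusion_maximal_def by blast
  also have "card M \<le> card {1..N}" using M(1) C(1) by (intro card_mono) auto
  finally have nN: "n \<le> N" by simp
  have l1: "log 2 (2 * real k) \<ge> 1" using \<open>k > 0\<close> by (simp add: le_log_iff)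
  have "2 * real k \<le> 2 ^ 13 * real k * 1" by simp
  also have "\<dots> \<le> 2 ^ 13 * real k * log 2 (2 * real k)"
    using l1 by (intro mult_left_mono) auto
  finally have "2 * real k \<le> real n" using n1 by linarith
  then have "real n / real k \<ge> 2" using \<open>k > 0\<close> by (simp add: field_simps)
  then have "log 2 (real n / real k) \<ge> 1" by (subst le_log_iff) auto
  then have l2: "(log 2 (real n / real k))\<^sup>2 \<ge> 1" by simp
  have "real t * 1 \<le> real t * (2 ^ 19 * real k)"
    using \<open>k > 0\<close> by (intro mult_left_mono) auto
  also have "\<dots> = 2 ^ 19 * real t * real k * 1" by simp
  also have "\<dots> \<le> 2 ^ 19 * real t * real k * (log 2 (real n / real k))\<^sup>2"
    using l2 by (intro mult_left_mono) auto
  finally have "real t \<le> real n" using n2 by linarith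
  with nN show ?thesis by simp
qed

end

theory Submission
  imports Defs
begin

text \<open>
  If every inclusion-maximal face has size at least \<open>n\<close>, then exchanging one element shows that each star
  of \<open>layer \<C> k\<close> is spread with parameter about \<open>n / k\<close>. Two cross-\<open>t\<close>-intersecting
  families that are spread around small sets \<open>B1\<close>, \<open>B2\<close> force \<open>t \<le> card (B1 \<inter> B2)\<close>: a random
  2-colouring of the ground set separates suitable members outside \<open>B1\<close> and \<open>B2\<close> (the spread lemma of
  Alweiss, Lovett, Wu and Zhang, proved by counting minimum fragments as Park and Pham do). So the sets
  of size at most \<open>q\<close> around which some subfamily of \<open>\<F>\<close> is spread form a \<open>t\<close>-intersecting family
  \<open>S\<close> whose stars cover \<open>\<F>\<close> up to few members. Unless the members of \<open>S\<close> share a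
  \<open>t\<close>-set \<open>T\<close>, a maximal \<open>t\<close>-intersecting extension of \<open>S\<close> has few minimal members of each
  size, and \<open>\<F>\<close> is small. Otherwise the members of \<open>\<F>\<close> not containing \<open>T\<close> have
  a spread core \<open>B\<close> with \<open>q < card B\<close>; about half of the members of the star of \<open>T\<close> that avoid
  \<open>B - T\<close> are then missing from \<open>\<F>\<close>, which outweighs the members outside the star.
\<close>

section \<open>The spread lemma\<close>

lemma sum_Pow_split:
  fixes f :: "'a set \<Rightarrow> 'a set \<Rightarrow> 'b::comm_monoid_add"
  assumes "finite X"
  shows "(\<Sum>U\<in>Pow X. \<Sum>W\<in>Pow U. f W (U - W)) = (\<Sum>W\<in>Pow X. \<Sum>V\<in>Pow (X - W). f W V)"
proof -
  have fin: "finite (Pow U)" if "U \<in> Pow X" for U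
    using that assms finite_subset by auto
  have "(\<Sum>U\<in>Pow X. \<Sum>W\<in>Pow U. f W (U - W)) = (\<Sum>(U, W)\<in>Sigma (Pow X) Pow. f W (U - W))"
    using assms fin by (intro sum.Sigma) auto
  also have "\<dots> = (\<Sum>(W, V)\<in>Sigma (Pow X) (\<lambda>W. Pow (X - W)). f W V)"
    by (rule sum.reindex_bij_witness[where i = "\<lambda>(W, V). (W \<union> V, W)" and j = "\<lambda>(U, W). (W, U - W)"])
      (auto intro!: arg_cong[where f = "f _"])
  also have "\<dots> = (\<Sum>W\<in>Pow X. \<Sum>V\<in>Pow (X - W). f W V)"
    using assms by (intro sum.Sigma[symmetric]) auto
  finally show ?thesis .
qed

text \<open>The binomial theorem, summed over subsets instead of sizes. For positive reals it is the
  normalising constant of a random subset that takes each point with probability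
  \<open>a / (a + b)\<close>; probabilities below are kept as such unnormalised weights.\<close>

lemma sum_Pow_power:
  fixes a b :: "'b::comm_semiring_1"
  assumes "finite X"
  shows "(\<Sum>U\<in>Pow X. a ^ card U * b ^ card (X - U)) = (a + b) ^ card X"
  using prod_add[OF assms, of "\<lambda>_. a" "\<lambda>_. b"] by simp

section \<open>Minimum fragments\<close>

text \<open>The family is indexed by \<open>I\<close> because several indices may get the same
  fragment, and the iteration below has to count these with multiplicity.\<close>

definition fragment :: "'i set \<Rightarrow> ('i \<Rightarrow> 'a set) \<Rightarrow> 'a set \<Rightarrow> 'i \<Rightarrow> 'a set" where
  "fragment I T W s = arg_min card (\<lambda>Q. \<exists>s'\<in>I. Q = T s' - W \<and> T s' \<subseteq> T s \<union> W)"

lemma fragment: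
  assumes "s \<in> I"
  shows fragment_eq: "\<exists>s'\<in>I. fragment I T W s = T s' - W \<and> T s' \<subseteq> T s \<union> W"
    and fragment_least: "\<And>s'. s' \<in> I \<Longrightarrow> T s' \<subseteq> T s \<union> W \<Longrightarrow> card (fragment I T W s) \<le> card (T s' - W)"
proof -
  let ?P = "\<lambda>Q. \<exists>s'\<in>I. Q = T s' - W \<and> T s' \<subseteq> T s \<union> W"
  have "?P (T s - W)"
    using assms by auto
  from arg_min_nat_lemma[of ?P, OF this, of card]
  show "\<exists>s'\<in>I. fragment I T W s = T s' - W \<and> T s' \<subseteq> T s \<union> W"
    and "\<And>s'. s' \<in> I \<Longrightarrow> T s' \<subseteq> T s \<union> W \<Longrightarrow> card (fragment I T W s) \<le> card (T s' - W)"
    unfolding fragment_def by blast+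
qed

lemma fragment_subset: "s \<in> I \<Longrightarrow> fragment I T W s \<subseteq> T s - W"
  using fragment_eq[of s I T W] by blast

text \<open>Given \<open>Z = W \<union> fragment I T W s\<close>, any member \<open>T u\<close> inside \<open>Z\<close> contains the fragment by
  minimality. Hence \<open>Z\<close> leaves at most \<open>2 ^ m\<close> possibilities for the fragment, and spreadness then
  leaves few possibilities for \<open>s\<close>.\<close>

lemma fragment_subset_member:
  assumes "s \<in> I" "u \<in> I" "finite (T s)" "T u \<subseteq> W \<union> fragment I T W s"
  shows "fragment I T W s \<subseteq> T u"
proof -
  let ?Q = "fragment I T W s"
  have Q: "?Q \<subseteq> T s - W" "finite ?Q"
    using fragment_subset[OF assms(1), of T W] assms(3) finite_subset by auto
  have "card ?Q \<le> card (T u - W)"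
    using Q assms by (intro fragment_least) auto
  moreover have "T u - W \<subseteq> ?Q"
    using assms(4) by auto
  ultimately have "T u - W = ?Q"
    using Q by (simp add: card_seteq)
  then show ?thesis by auto
qed

text \<open>Encode a pair \<open>(W, s)\<close> by \<open>(Z, Q, s)\<close>, where \<open>Q\<close>
  is the fragment and \<open>Z = W \<union> Q\<close>. At most \<open>2 ^ m\<close> sets
  \<open>Q\<close> belong to a given \<open>Z\<close>, and spreadness leaves at most
  \<open>D / R ^ card Q\<close> indices for each. After division by \<open>(1 + a) ^ card X\<close>
  this is an expectation over a random \<open>W\<close> that takes each point with probability
  \<open>1 / (1 + a)\<close>.\<close>

lemma sum_long_fragments:
  fixes a R D :: real
  assumes X: "finite X" and I: "finite I" "\<And>s. s \<in> I \<Longrightarrow> T s \<subseteq> X" "\<And>s. s \<in> I \<Longrightarrow> card (T s) \<le> m"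
    and spread: "\<And>B. B \<noteq> {} \<Longrightarrow> R ^ card B * card {s\<in>I. B \<subseteq> T s} \<le> D"
    and R: "0 < R" "0 \<le> a" "16 * a \<le> R" and "0 \<le> D"
  shows "(\<Sum>W\<in>Pow X. a ^ card (X - W) * card {s\<in>I. h < card (fragment I T W s)})
    \<le> 2 ^ m * (1 / 16) ^ Suc h * D * (1 + a) ^ card X"
proof -
  \<comment> \<open>The reference member depends on \<open>Z\<close> only, so all long fragments
    that lead to \<open>Z\<close> lie in one power set with at most \<open>2 ^ m\<close>
    elements.\<close>
  define u where "u Z = (SOME u. u \<in> I \<and> T u \<subseteq> Z)" for Z
  define \<Q> where "\<Q> Z = (if \<exists>u\<in>I. T u \<subseteq> Z then {Q. Q \<subseteq> T (u Z) \<and> h < card Q} else {})" for Z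
  define P where "P = Sigma (Pow X) (\<lambda>W. {s\<in>I. h < card (fragment I T W s)})"
  define P' where "P' = Sigma (Pow X) (\<lambda>Z. Sigma (\<Q> Z) (\<lambda>Q. {s\<in>I. Q \<subseteq> T s}))"
  define g where "g = (\<lambda>(W, s). (W \<union> fragment I T W s, fragment I T W s, s))"
  have finT: "finite (T s)" if "s \<in> I" for s
    using I(2)[OF that] X finite_subset by auto
  have u: "u Z \<in> I" "T (u Z) \<subseteq> Z" if "\<exists>u\<in>I. T u \<subseteq> Z" for Z
    using someI_ex[of "\<lambda>u. u \<in> I \<and> T u \<subseteq> Z"] that unfolding u_def by auto
  have fin\<Q>: "finite (\<Q> Z)" and card\<Q>: "card (\<Q> Z) \<le> 2 ^ m" for Z
  proof -
    have "finite (\<Q> Z) \<and> card (\<Q> Z) \<le> 2 ^ m"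
    proof (cases "\<exists>u\<in>I. T u \<subseteq> Z")
      case True
      note uZ = u[OF this]
      have sub: "\<Q> Z \<subseteq> Pow (T (u Z))"
        using True unfolding \<Q>_def by auto
      have "card (\<Q> Z) \<le> card (Pow (T (u Z)))"
        using sub finT[OF uZ(1)] by (intro card_mono) auto
      also have "\<dots> \<le> 2 ^ m"
        using finT[OF uZ(1)] I(3)[OF uZ(1)] by (simp add: card_Pow)
      finally show ?thesis
        using sub finT[OF uZ(1)] finite_subset by auto
    qed (simp add: \<Q>_def)
    then show "finite (\<Q> Z)" "card (\<Q> Z) \<le> 2 ^ m" by auto
  qed
  have finP': "finite P'"
    unfolding P'_def using X I(1) fin\<Q> by (intro finite_SigmaI) auto
  have frag_sub: "fragment I T W s \<subseteq> T s" "fragment I T W s \<inter> W = {}" if "s \<in> I" for W s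
    using fragment_subset[OF that, of T W] by auto
  have inj: "inj_on g P"
  proof (rule inj_onI)
    fix x y assume "x \<in> P" "y \<in> P" "g x = g y"
    then obtain W W' s where xy: "x = (W, s)" "y = (W', s)" and s: "s \<in> I"
      and eq: "W \<union> fragment I T W s = W' \<union> fragment I T W' s" "fragment I T W s = fragment I T W' s"
      unfolding g_def P_def by auto
    have "W = W'"
      using eq frag_sub(2)[OF s, of W] frag_sub(2)[OF s, of W'] by blast
    then show "x = y"
      unfolding xy by simp
  qed
  have img: "g ` P \<subseteq> P'"
  proof
    fix z assume "z \<in> g ` P"
    then obtain W s where z: "z = (W \<union> fragment I T W s, fragment I T W s, s)"
      and W: "W \<subseteq> X" and s: "s \<in> I" "h < card (fragment I T W s)"
      unfolding P_def g_def by auto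
    let ?Z = "W \<union> fragment I T W s"
    have ex: "\<exists>u\<in>I. T u \<subseteq> ?Z"
      using fragment_eq[OF s(1), of T W] by auto
    note uZ = u[OF ex]
    have "fragment I T W s \<subseteq> T (u ?Z)"
      using fragment_subset_member[OF s(1) uZ(1) finT[OF s(1)] uZ(2)] .
    moreover have "?Z \<subseteq> X"
      using W frag_sub(1)[OF s(1), of W] I(2)[OF s(1)] by blast
    ultimately show "z \<in> P'"
      unfolding z P'_def \<Q>_def using s ex frag_sub(1)[OF s(1), of W] by simp
  qed
  have "(\<Sum>W\<in>Pow X. a ^ card (X - W) * card {s\<in>I. h < card (fragment I T W s)})
      = (\<Sum>W\<in>Pow X. \<Sum>s\<in>{s\<in>I. h < card (fragment I T W s)}. a ^ card (X - W))"
    by (simp add: mult.commute)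
  also have "\<dots> = (\<Sum>(W, s)\<in>P. a ^ card (X - W))"
    unfolding P_def using X I(1) by (intro sum.Sigma) auto
  \<comment> \<open>Passing from \<open>W\<close> to \<open>Z\<close> releases one factor
    \<open>a\<close> for each point of \<open>Q\<close>; against the factor \<open>R\<close> per
    point from spreadness, only \<open>1 / 16\<close> per point remains.\<close>
  also have "\<dots> = (\<Sum>(Z, Q, s)\<in>g ` P. a ^ (card (X - Z) + card Q))"
    unfolding sum.reindex[OF inj] o_def
  proof (rule sum.cong)
    fix x assume "x \<in> P"
    then obtain W s where x: "x = (W, s)" "W \<subseteq> X" "s \<in> I"
      unfolding P_def by auto
    let ?Q = "fragment I T W s"
    have "X - W = (X - (W \<union> ?Q)) \<union> ?Q" "(X - (W \<union> ?Q)) \<inter> ?Q = {}"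
      using x frag_sub[OF x(3), of W] I(2)[OF x(3)] by auto
    then have "card (X - W) = card (X - (W \<union> ?Q)) + card ?Q"
      using X finite_subset[OF frag_sub(1)[OF x(3)] finT[OF x(3)]]
      by (metis card_Un_disjoint finite_Diff)
    then show "(case x of (W, s) \<Rightarrow> a ^ card (X - W))
        = (case g x of (Z, Q, s) \<Rightarrow> a ^ (card (X - Z) + card Q))"
      unfolding x g_def by simp
  qed simp
  also have "\<dots> \<le> (\<Sum>(Z, Q, s)\<in>P'. a ^ (card (X - Z) + card Q))"
    using R by (intro sum_mono2 finP' img) auto
  also have "\<dots> = (\<Sum>Z\<in>Pow X. \<Sum>x\<in>Sigma (\<Q> Z) (\<lambda>Q. {s\<in>I. Q \<subseteq> T s}).
      case x of (Q, s) \<Rightarrow> a ^ (card (X - Z) + card Q))"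
    unfolding P'_def using X I(1) fin\<Q> by (subst sum.Sigma) auto
  also have "\<dots> = (\<Sum>Z\<in>Pow X. \<Sum>Q\<in>\<Q> Z. \<Sum>s\<in>{s\<in>I. Q \<subseteq> T s}. a ^ (card (X - Z) + card Q))"
    using I(1) fin\<Q> by (intro sum.cong refl sum.Sigma[symmetric]) auto
  also have "\<dots> \<le> (\<Sum>Z\<in>Pow X. \<Sum>Q\<in>\<Q> Z. a ^ card (X - Z) * ((1 / 16) ^ Suc h * D))"
  proof (intro sum_mono)
    fix Z Q assume "Q \<in> \<Q> Z"
    then have Q: "h < card Q" unfolding \<Q>_def by (auto split: if_splits)
    then have "Q \<noteq> {}" by auto
    have "a ^ card Q * card {s\<in>I. Q \<subseteq> T s} \<le> (R / 16) ^ card Q * card {s\<in>I. Q \<subseteq> T s}"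
      using R by (intro mult_right_mono power_mono) auto
    also have "\<dots> = (1 / 16) ^ card Q * (R ^ card Q * card {s\<in>I. Q \<subseteq> T s})"
      by (simp add: power_divide)
    also have "\<dots> \<le> (1 / 16) ^ Suc h * D"
      using spread[OF \<open>Q \<noteq> {}\<close>] Q R by (intro mult_mono power_decreasing) auto
    finally have "a ^ card (X - Z) * (a ^ card Q * card {s\<in>I. Q \<subseteq> T s})
        \<le> a ^ card (X - Z) * ((1 / 16) ^ Suc h * D)"
      using R by (intro mult_left_mono) auto
    then show "(\<Sum>s\<in>{s\<in>I. Q \<subseteq> T s}. a ^ (card (X - Z) + card Q))
        \<le> a ^ card (X - Z) * ((1 / 16) ^ Suc h * D)"
      by (simp add: power_add mult_ac)
  qed
  also have "\<dots> \<le> (\<Sum>Z\<in>Pow X. 2 ^ m * (a ^ card (X - Z) * ((1 / 16) ^ Suc h * D)))"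
  proof (intro sum_mono)
    fix Z
    have "real (card (\<Q> Z)) \<le> 2 ^ m"
      using card\<Q>[of Z] by (metis of_nat_le_iff of_nat_numeral of_nat_power)
    then show "(\<Sum>Q\<in>\<Q> Z. a ^ card (X - Z) * ((1 / 16) ^ Suc h * D))
        \<le> 2 ^ m * (a ^ card (X - Z) * ((1 / 16) ^ Suc h * D))"
      using R \<open>0 \<le> D\<close> by (simp only: sum_constant) (intro mult_right_mono, auto)
  qed
  also have "\<dots> = 2 ^ m * (1 / 16) ^ Suc h * D * (\<Sum>Z\<in>Pow X. 1 ^ card Z * a ^ card (X - Z))"
    unfolding sum_distrib_left by (simp add: mult_ac)
  also have "\<dots> = 2 ^ m * (1 / 16) ^ Suc h * D * (1 + a) ^ card X"
    unfolding sum_Pow_power[OF X] ..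
  finally show ?thesis .
qed

text \<open>Think of \<open>U\<close> as composed of \<open>l\<close> random rounds of weight 1
  each, the points outside having weight \<open>b\<close>. The induction exposes one round
  \<open>W\<close> and replaces the sets by their fragments, whose size bound is halved except for
  few indices. Since \<open>m < 2 ^ l\<close>, the bound reaches 0 in time, and an empty set lies in
  every \<open>U\<close>. The factor \<open>1 - (1 / 2) ^ m\<close> leaves room for the accumulated
  errors.\<close>

lemma sum_avoiding_subsets:
  fixes b R D :: real
  assumes X: "finite X" and I: "finite I" "\<And>s. s \<in> I \<Longrightarrow> T s \<subseteq> X" "\<And>s. s \<in> I \<Longrightarrow> card (T s) \<le> m"
    and spread: "\<And>B. B \<noteq> {} \<Longrightarrow> R ^ card B * card {s\<in>I. B \<subseteq> T s} \<le> D"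
    and "0 < R" "0 \<le> b" "16 * (real l + b) \<le> R" "0 \<le> D" "m < 2 ^ l"
  shows "real (card I) * (\<Sum>U\<in>{U\<in>Pow X. \<forall>s\<in>I. \<not> T s \<subseteq> U}. real l ^ card U * b ^ card (X - U))
    \<le> 1 / 4 * (1 - (1 / 2) ^ m) * D * (real l + b) ^ card X"
  using assms
proof (induction l arbitrary: X I T m)
  case 0
  then have "m = 0" by simp
  have "T s = {}" if "s \<in> I" for s
    using "0.prems"(3,4)[OF that] \<open>m = 0\<close> finite_subset[OF _ "0.prems"(1), of "T s"] by simp
  then have "card I = 0 \<or> {U \<in> Pow X. \<forall>s\<in>I. \<not> T s \<subseteq> U} = {}"
    by auto
  then show ?case
    using \<open>m = 0\<close> by (elim disjE) (simp_all only: sum.empty, simp_all)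
next
  case (Suc l)
  note X = Suc.prems(1) and I = Suc.prems(2-4) and spread = Suc.prems(5)
    and nums = Suc.prems(6-9) and m = Suc.prems(10)
  define L where "L = real l"
  have SL: "real (Suc l) = 1 + L" unfolding L_def by simp
  have L: "0 \<le> L" "16 * (L + b) \<le> R" using nums unfolding L_def by auto
  have finT: "finite (T s)" if "s \<in> I" for s
    using I(2)[OF that] X finite_subset by auto
  show ?case
  proof (cases "m = 0")
    case True
    have "T s = {}" if "s \<in> I" for s
      using I(3)[OF that] finT[OF that] True by auto
    then have "card I = 0 \<or> {U \<in> Pow X. \<forall>s\<in>I. \<not> T s \<subseteq> U} = {}"
      by auto
    then show ?thesis
      using True by (elim disjE) (simp_all only: sum.empty, simp_all)
  next
    case False
    define h where "h = m div 2"
    define J where "J W = {s\<in>I. card (fragment I T W s) \<le> h}" for W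
    define K where "K W = {s\<in>I. h < card (fragment I T W s)}" for W
    define bad where "bad U \<longleftrightarrow> (\<forall>s\<in>I. \<not> T s \<subseteq> U)" for U
    \<comment> \<open>The weight of the failures in the later rounds \<open>V\<close>, once the
      first round \<open>W\<close> is fixed.\<close>
    define S where "S W = (\<Sum>V\<in>{V\<in>Pow (X - W). bad (W \<union> V)}. L ^ card V * b ^ card (X - W - V))" for W
    have JK: "card I = card (J W) + card (K W)" for W
    proof -
      have "I = J W \<union> K W" "J W \<inter> K W = {}"
        unfolding J_def K_def by auto
      then show ?thesis
        using I(1) by (metis card_Un_disjoint finite_Un)
    qed
    \<comment> \<open>Each point of \<open>U\<close> belongs to the first round (weight 1) or to a
      later one (weight \<open>L\<close>), so \<open>(1 + L) ^ card U\<close> expands over the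
      subsets \<open>W\<close> of \<open>U\<close>.\<close>
    have split: "(\<Sum>U\<in>{U\<in>Pow X. bad U}. real (Suc l) ^ card U * b ^ card (X - U)) = (\<Sum>W\<in>Pow X. S W)"
    proof -
      have "(\<Sum>U\<in>{U\<in>Pow X. bad U}. real (Suc l) ^ card U * b ^ card (X - U))
          = (\<Sum>U\<in>Pow X. if bad U then real (Suc l) ^ card U * b ^ card (X - U) else 0)"
        using X by (intro sum.inter_filter) auto
      also have "\<dots> = (\<Sum>U\<in>Pow X. \<Sum>W\<in>Pow U.
          if bad (W \<union> (U - W)) then L ^ card (U - W) * b ^ card (X - W - (U - W)) else 0)"
      proof (rule sum.cong)
        fix U assume U: "U \<in> Pow X"
        then have "finite U" using X finite_subset by auto
        have "(\<Sum>W\<in>Pow U. if bad (W \<union> (U - W)) then L ^ card (U - W) * b ^ card (X - W - (U - W)) else 0)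
          = (\<Sum>W\<in>Pow U. if bad U then (1 ^ card W * L ^ card (U - W)) * b ^ card (X - U) else 0)"
        proof (rule sum.cong)
          fix W assume "W \<in> Pow U"
          then have "W \<union> (U - W) = U" "X - W - (U - W) = X - U" by auto
          then show "(if bad (W \<union> (U - W)) then L ^ card (U - W) * b ^ card (X - W - (U - W)) else 0)
            = (if bad U then (1 ^ card W * L ^ card (U - W)) * b ^ card (X - U) else 0)"
            by simp
        qed simp
        also have "\<dots> = (if bad U then (\<Sum>W\<in>Pow U. 1 ^ card W * L ^ card (U - W)) * b ^ card (X - U) else 0)"
          by (simp add: sum_distrib_right)
        finally show "(if bad U then real (Suc l) ^ card U * b ^ card (X - U) else 0)
          = (\<Sum>W\<in>Pow U. if bad (W \<union> (U - W)) then L ^ card (U - W) * b ^ card (X - W - (U - W)) else 0)"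
          unfolding sum_Pow_power[OF \<open>finite U\<close>] SL by simp
      qed simp
      also have "\<dots> = (\<Sum>W\<in>Pow X. \<Sum>V\<in>Pow (X - W).
          if bad (W \<union> V) then L ^ card V * b ^ card (X - W - V) else 0)"
        by (rule sum_Pow_split[OF X])
      also have "\<dots> = (\<Sum>W\<in>Pow X. S W)"
        unfolding S_def using X by (intro sum.cong refl sum.inter_filter[symmetric]) auto
      finally show ?thesis .
    qed
    have S_le: "S W \<le> (L + b) ^ card (X - W)" for W
    proof -
      have "S W \<le> (\<Sum>V\<in>Pow (X - W). L ^ card V * b ^ card (X - W - V))"
        unfolding S_def using X L nums by (intro sum_mono2) auto
      also have "\<dots> = (L + b) ^ card (X - W)"
        using X by (intro sum_Pow_power) auto
      finally show ?thesis .
    qed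
    have S_J: "real (card (J W)) * S W \<le> 1 / 4 * (1 - (1 / 2) ^ h) * D * (L + b) ^ card (X - W)" for W
    proof -
      have sub: "fragment I T W s \<subseteq> T s - W" if "s \<in> I" for s
        using fragment_subset[OF that] .
      \<comment> \<open>A fragment has the form \<open>T s' - W\<close>; if it lay in
        \<open>V\<close>, then \<open>T s'\<close> would lie in \<open>W \<union> V\<close>.\<close>
      have "S W \<le> (\<Sum>V\<in>{V\<in>Pow (X - W). \<forall>s\<in>J W. \<not> fragment I T W s \<subseteq> V}. L ^ card V * b ^ card (X - W - V))"
        unfolding S_def
      proof (rule sum_mono2)
        show "{V \<in> Pow (X - W). bad (W \<union> V)} \<subseteq> {V \<in> Pow (X - W). \<forall>s\<in>J W. \<not> fragment I T W s \<subseteq> V}"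
        proof safe
          fix V s assume "bad (W \<union> V)" "s \<in> J W" "fragment I T W s \<subseteq> V"
          moreover obtain s' where "s' \<in> I" "fragment I T W s = T s' - W"
            using fragment_eq[of s I T W] \<open>s \<in> J W\<close> unfolding J_def by auto
          ultimately show False
            unfolding bad_def by auto
        qed
      qed (use X L nums in auto)
      then have "real (card (J W)) * S W \<le> real (card (J W)) *
          (\<Sum>V\<in>{V\<in>Pow (X - W). \<forall>s\<in>J W. \<not> fragment I T W s \<subseteq> V}. L ^ card V * b ^ card (X - W - V))"
        by (intro mult_left_mono) auto
      also have "\<dots> \<le> 1 / 4 * (1 - (1 / 2) ^ h) * D * (L + b) ^ card (X - W)"
        unfolding L_def
      proof (rule Suc.IH)
        show "R ^ card B * real (card {s \<in> J W. B \<subseteq> fragment I T W s}) \<le> D" if "B \<noteq> {}" for B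
        proof -
          have "{s \<in> J W. B \<subseteq> fragment I T W s} \<subseteq> {s \<in> I. B \<subseteq> T s}"
            using sub unfolding J_def by fastforce
          then have "card {s \<in> J W. B \<subseteq> fragment I T W s} \<le> card {s \<in> I. B \<subseteq> T s}"
            using I(1) by (intro card_mono) auto
          then have "R ^ card B * real (card {s \<in> J W. B \<subseteq> fragment I T W s}) \<le> R ^ card B * card {s \<in> I. B \<subseteq> T s}"
            using nums by (intro mult_left_mono) auto
          then show ?thesis
            using spread[OF that] by linarith
        qed
        show "fragment I T W s \<subseteq> X - W" if "s \<in> J W" for s
          using sub[of s] I(2)[of s] that unfolding J_def by auto
      qed (use X I nums L m in \<open>auto simp: J_def h_def L_def\<close>)
      finally show ?thesis .
    qed
    have "real (card I) * (\<Sum>U\<in>{U\<in>Pow X. bad U}. real (Suc l) ^ card U * b ^ card (X - U))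
        = (\<Sum>W\<in>Pow X. real (card (J W)) * S W + real (card (K W)) * S W)"
      unfolding split sum_distrib_left
    proof (rule sum.cong)
      show "real (card I) * S W = real (card (J W)) * S W + real (card (K W)) * S W" for W
        unfolding JK[of W] by (simp add: algebra_simps)
    qed simp
    \<comment> \<open>Indices with a short fragment fall under the induction hypothesis. For those
      with a long one the trivial bound \<open>S_le\<close> is enough, because
      \<open>sum_long_fragments\<close> shows that they are few.\<close>
    also have "\<dots> \<le> (\<Sum>W\<in>Pow X. 1 / 4 * (1 - (1 / 2) ^ h) * D * (L + b) ^ card (X - W)
        + (L + b) ^ card (X - W) * real (card (K W)))"
    proof (intro sum_mono add_mono S_J)
      show "real (card (K W)) * S W \<le> (L + b) ^ card (X - W) * real (card (K W))" for W
        using mult_left_mono[OF S_le, of "real (card (K W))" W] by (simp add: mult_ac)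
    qed
    also have "\<dots> = 1 / 4 * (1 - (1 / 2) ^ h) * D * (\<Sum>W\<in>Pow X. 1 ^ card W * (L + b) ^ card (X - W))
        + (\<Sum>W\<in>Pow X. (L + b) ^ card (X - W) * real (card (K W)))"
      by (simp add: sum.distrib sum_distrib_left)
    also have "\<dots> \<le> 1 / 4 * (1 - (1 / 2) ^ h) * D * (1 + (L + b)) ^ card X
        + 2 ^ m * (1 / 16) ^ Suc h * D * (1 + (L + b)) ^ card X"
      unfolding sum_Pow_power[OF X] K_def
      using sum_long_fragments[OF X I, where R = R and D = D and a = "L + b" and h = h] spread nums L by auto
    also have "\<dots> = (1 / 4 * (1 - (1 / 2) ^ h) + 2 ^ m * (1 / 16) ^ Suc h) * D * (1 + (L + b)) ^ card X"
      by (simp add: algebra_simps)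
    also have "\<dots> \<le> 1 / 4 * (1 - (1 / 2) ^ m) * D * (1 + (L + b)) ^ card X"
    proof -
      \<comment> \<open>The first inequality bounds the new error by
        \<open>1 / 4 * (1 / 2) ^ m\<close>; the second shows that the gain from halving,
        \<open>1 / 4 * ((1 / 2) ^ h - (1 / 2) ^ m)\<close>, is at least as large.\<close>
      have le: "m \<le> 2 * h + 1" "Suc h \<le> m"
        unfolding h_def using False by auto
      have "(2::real) ^ m * (1 / 16) ^ Suc h = 2 ^ m * (1 / 2) ^ (4 * Suc h)"
        unfolding power_mult by (simp add: power_divide)
      also have "\<dots> \<le> 2 ^ m * (1 / 2) ^ (2 * m + 2)"
        using le by (intro mult_left_mono power_decreasing) auto
      also have "\<dots> = (2 ^ m * (1 / 2) ^ m) * (1 / 2) ^ m * (1 / 2)\<^sup>2"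
        unfolding mult_2 power_add by (simp only: mult.assoc)
      also have "\<dots> = 1 / 4 * (1 / 2) ^ m"
        unfolding power_mult_distrib[symmetric] by (simp add: power2_eq_square)
      finally have 1: "(2::real) ^ m * (1 / 16) ^ Suc h \<le> 1 / 4 * (1 / 2) ^ m" .
      have "(1 / 2 :: real) ^ m \<le> (1 / 2) ^ Suc h"
        using le by (intro power_decreasing) auto
      then have 2: "2 * (1 / 2 :: real) ^ m \<le> (1 / 2) ^ h"
        by simp
      have "1 / 4 * (1 - y) + p \<le> 1 / 4 * (1 - x)" if "p \<le> 1 / 4 * x" "2 * x \<le> y" for x y p :: real
        using that by argo
      from this[OF 1 2] have "1 / 4 * (1 - (1 / 2) ^ h) + 2 ^ m * (1 / 16) ^ Suc h \<le> 1 / 4 * (1 - (1 / 2 :: real) ^ m)" .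
      then show ?thesis
        using nums L by (intro mult_right_mono) auto
    qed
    finally show ?thesis
      unfolding bad_def SL by (simp add: add.assoc)
  qed
qed

section \<open>Spread families of sets\<close>

text \<open>The bound \<open>D\<close> is kept apart from \<open>card G\<close>, so that a subfamily
  inherits it unchanged. Discarding up to half of the members then costs only a factor 2 between
  \<open>D\<close> and the size.\<close>

definition spread_over :: "real \<Rightarrow> real \<Rightarrow> 'a set \<Rightarrow> 'a set set \<Rightarrow> bool" where
  "spread_over R D B G \<longleftrightarrow> (\<forall>Z. B \<subseteq> Z \<longrightarrow> R ^ card (Z - B) * card (star G Z) \<le> D)"

lemma spread_overD: "spread_over R D B G \<Longrightarrow> B \<subseteq> Z \<Longrightarrow> R ^ card (Z - B) * card (star G Z) \<le> D"
  unfolding spread_over_def by blast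

lemma finite_star: "finite G \<Longrightarrow> finite (star G B)"
  unfolding star_def by simp

lemma star_subset: "star G B \<subseteq> G"
  unfolding star_def by auto

lemma star_star: "B \<subseteq> Z \<Longrightarrow> star (star G B) Z = star G Z"
  unfolding star_def by auto

lemma star_mono: "G \<subseteq> H \<Longrightarrow> star G B \<subseteq> star H B"
  unfolding star_def by auto

lemma card_star_mono: "finite H \<Longrightarrow> G \<subseteq> H \<Longrightarrow> card (star G B) \<le> card (star H B)"
  by (intro card_mono finite_star star_mono)

lemma spread_over_mono:
  assumes "spread_over R' D B H" "finite H" "G \<subseteq> H" "0 \<le> R" "R \<le> R'"
  shows "spread_over R D B G"
  unfolding spread_over_def
proof safe
  fix Z assume "B \<subseteq> Z"
  have "R ^ card (Z - B) * card (star G Z) \<le> R' ^ card (Z - B) * card (star H Z)"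
    using assms card_star_mono[OF assms(2,3), of Z] by (intro mult_mono power_mono) auto
  then show "R ^ card (Z - B) * card (star G Z) \<le> D"
    using spread_overD[OF assms(1) \<open>B \<subseteq> Z\<close>] by linarith
qed

section \<open>Separation by a random 2-colouring\<close>

text \<open>With \<open>b = l\<close> all subsets \<open>U\<close> have equal weight, and
  \<open>16 * (l + b)\<close> becomes \<open>32 * l\<close>. The failure probability times
  \<open>card G\<close> is then below \<open>D / 4\<close>, hence below
  \<open>card G / 2\<close>.\<close>

lemma card_avoiding_subsets:
  assumes X: "finite X" "G \<subseteq> Pow X" and B: "\<And>F. F \<in> G \<Longrightarrow> B \<subseteq> F"
    and k: "\<And>F. F \<in> G \<Longrightarrow> card F \<le> k" "k < 2 ^ l" "0 < l"
    and G: "spread_over R D B G" "0 < D" "D \<le> 2 * real (card G)" and R: "32 * real l \<le> R"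
  shows "2 * card {U\<in>Pow X. \<forall>F\<in>G. \<not> F - B \<subseteq> U} < 2 ^ card X"
proof -
  define bad where "bad = {U\<in>Pow X. \<forall>F\<in>G. \<not> F - B \<subseteq> U}"
  have finG: "finite G"
    using X finite_subset by auto
  have "real (card G) * (\<Sum>U\<in>bad. real l ^ card U * real l ^ card (X - U))
      \<le> 1 / 4 * (1 - (1 / 2) ^ k) * D * (real l + real l) ^ card X"
    unfolding bad_def
  proof (rule sum_avoiding_subsets[OF X(1) finG])
    show "card (F - B) \<le> k" if "F \<in> G" for F
    proof -
      have "finite F" using that X by (auto intro: finite_subset)
      then have "card (F - B) \<le> card F" by (intro card_mono) auto
      then show ?thesis using k(1)[OF that] by linarith
    qed
    show "R ^ card Z * real (card {F \<in> G. Z \<subseteq> F - B}) \<le> D" for Z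
    proof (cases "Z \<inter> B = {}")
      case True
      then have Z: "B \<union> Z - B = Z" by auto
      have "{F \<in> G. Z \<subseteq> F - B} = star G (B \<union> Z)"
        using B True unfolding star_def by auto
      then show ?thesis
        using spread_overD[OF G(1), of "B \<union> Z"] Z by simp
    next
      case False
      then have "{F \<in> G. Z \<subseteq> F - B} = {}" by auto
      then show ?thesis
        unfolding \<open>{F \<in> G. Z \<subseteq> F - B} = {}\<close> using G(2) by simp
    qed
  qed (use X k R G in auto)
  also have "(\<Sum>U\<in>bad. real l ^ card U * real l ^ card (X - U)) = (\<Sum>U\<in>bad. real l ^ card X)"
  proof (rule sum.cong)
    fix U assume "U \<in> bad"
    then have "U \<subseteq> X" "finite U"
      using X(1) unfolding bad_def by (auto intro: finite_subset)
    then have "card U + card (X - U) = card X"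
      using X(1) by (simp add: card_Diff_subset card_mono)
    then show "real l ^ card U * real l ^ card (X - U) = real l ^ card X"
      by (metis power_add)
  qed simp
  finally have "(real (card G) * card bad) * real l ^ card X
      \<le> (1 / 4 * (1 - (1 / 2) ^ k) * D * 2 ^ card X) * real l ^ card X"
    by (simp add: power_mult_distrib mult_2[symmetric] mult_ac)
  then have "real (card G) * card bad \<le> 1 / 4 * (1 - (1 / 2) ^ k) * D * 2 ^ card X"
    using \<open>0 < l\<close> by (simp add: mult_le_cancel_right)
  also have "\<dots> < 1 / 4 * 1 * D * 2 ^ card X"
    using G(2) by (intro mult_strict_right_mono mult_strict_left_mono) auto
  also have "\<dots> \<le> real (card G) * (1 / 2 * 2 ^ card X)"
    using mult_right_mono[OF G(3), of "2 ^ card X"] by simp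
  finally have "real (card bad) < 1 / 2 * 2 ^ card X"
    by (rule mult_left_less_imp_less) simp
  then have "real (2 * card bad) < real (2 ^ card X)"
    by simp
  then show ?thesis
    unfolding bad_def of_nat_less_iff .
qed

text \<open>A uniformly random \<open>U\<close> has the same distribution as its complement. Both
  failures have probability strictly below one half, so some \<open>U\<close> contains a suitable
  set from \<open>G1\<close> while its complement contains one from \<open>G2\<close>.\<close>

lemma spread_over_disjoint:
  assumes X: "finite X" and G: "G1 \<subseteq> Pow X" "G2 \<subseteq> Pow X"
    and B: "\<And>F. F \<in> G1 \<Longrightarrow> B1 \<subseteq> F" "\<And>F. F \<in> G2 \<Longrightarrow> B2 \<subseteq> F"
    and k: "\<And>F. F \<in> G1 \<union> G2 \<Longrightarrow> card F \<le> k" "k < 2 ^ l" "0 < l"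
    and spread: "spread_over R D1 B1 G1" "0 < D1" "D1 \<le> 2 * real (card G1)"
      "spread_over R D2 B2 G2" "0 < D2" "D2 \<le> 2 * real (card G2)" and R: "32 * real l \<le> R"
  shows "\<exists>F1\<in>G1. \<exists>F2\<in>G2. (F1 - B1) \<inter> (F2 - B2) = {}"
proof -
  define bad1 where "bad1 = {U\<in>Pow X. \<forall>F\<in>G1. \<not> F - B1 \<subseteq> U}"
  define bad2 where "bad2 = {U\<in>Pow X. \<forall>F\<in>G2. \<not> F - B2 \<subseteq> U}"
  have fin: "finite bad1" "finite bad2"
    using X unfolding bad1_def bad2_def by auto
  have "2 * card bad1 < 2 ^ card X" "2 * card bad2 < 2 ^ card X"
    unfolding bad1_def bad2_def
    using card_avoiding_subsets[OF X G(1) B(1) _ k(2,3) spread(1-3) R]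
      card_avoiding_subsets[OF X G(2) B(2) _ k(2,3) spread(4-6) R] k(1) by auto
  moreover have "card ((\<lambda>U. X - U) ` bad2) \<le> card bad2"
    using fin by (intro card_image_le) auto
  moreover have "card (bad1 \<union> (\<lambda>U. X - U) ` bad2) \<le> card bad1 + card ((\<lambda>U. X - U) ` bad2)"
    by (rule card_Un_le)
  ultimately have "card (bad1 \<union> (\<lambda>U. X - U) ` bad2) < card (Pow X)"
    unfolding card_Pow[OF X] by linarith
  then have "\<not> Pow X \<subseteq> bad1 \<union> (\<lambda>U. X - U) ` bad2"
    using fin card_mono[of "bad1 \<union> (\<lambda>U. X - U) ` bad2" "Pow X"] by auto
  then obtain U where U: "U \<subseteq> X" "U \<notin> bad1" "U \<notin> (\<lambda>U. X - U) ` bad2"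
    by auto
  have "X - U \<notin> bad2"
  proof
    assume "X - U \<in> bad2"
    moreover have "U = X - (X - U)" using U(1) by auto
    ultimately show False using U(3) by blast
  qed
  then obtain F2 where "F2 \<in> G2" "F2 - B2 \<subseteq> X - U"
    unfolding bad2_def by auto
  moreover obtain F1 where "F1 \<in> G1" "F1 - B1 \<subseteq> U"
    using U(1,2) unfolding bad1_def by auto
  ultimately show ?thesis by blast
qed

section \<open>Members that meet a small set outside the core\<close>

text \<open>A union bound over the points \<open>x\<close> of \<open>E - B\<close>, with spreadness
  applied to \<open>insert x B\<close>.\<close>

lemma card_hitting:
  fixes R D :: real
  assumes "finite G" "finite E" "\<And>F. F \<in> G \<Longrightarrow> B \<subseteq> F" "spread_over R D B G" "0 \<le> R"
  shows "R * card {F\<in>G. F \<inter> (E - B) \<noteq> {}} \<le> card (E - B) * D"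
proof -
  have "card {F\<in>G. F \<inter> (E - B) \<noteq> {}} \<le> card (\<Union>x\<in>E - B. star G (insert x B))"
    using assms by (intro card_mono finite_UN_I finite_star) (auto simp: star_def)
  also have "\<dots> \<le> (\<Sum>x\<in>E - B. card (star G (insert x B)))"
    using assms by (intro card_UN_le) auto
  finally have "R * card {F\<in>G. F \<inter> (E - B) \<noteq> {}} \<le> R * (\<Sum>x\<in>E - B. real (card (star G (insert x B))))"
    using assms by (intro mult_left_mono) (auto simp flip: of_nat_sum)
  also have "\<dots> \<le> (\<Sum>x\<in>E - B. D)"
    unfolding sum_distrib_left
  proof (intro sum_mono)
    fix x assume "x \<in> E - B"
    then have "insert x B - B = {x}" by auto
    then show "R * real (card (star G (insert x B))) \<le> D"
      using spread_overD[OF assms(4), of "insert x B"] by auto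
  qed
  finally show ?thesis by simp
qed

lemma card_not_hitting:
  fixes R :: real
  assumes "finite G" "finite E" "\<And>F. F \<in> G \<Longrightarrow> B \<subseteq> F" "spread_over R (card G) B G"
    "2 * real (card E) \<le> R"
  shows "card G \<le> 2 * card {F\<in>G. F \<inter> (E - B) = {}}"
proof (cases "E - B = {}")
  case False
  then have "E \<noteq> {}" by auto
  then have "0 < card E" using assms(2) by auto
  then have "0 < R" using assms(5) by linarith
  let ?h = "{F\<in>G. F \<inter> (E - B) \<noteq> {}}"
  have "card (E - B) \<le> card E"
    using assms(2) by (intro card_mono) auto
  then have "2 * real (card (E - B)) \<le> R" using assms(5) by linarith
  have "R * (2 * card ?h) \<le> 2 * real (card (E - B)) * card G"
    using card_hitting[OF assms(1-4)] \<open>0 < R\<close> by simp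
  also have "\<dots> \<le> R * card G"
    using \<open>2 * real (card (E - B)) \<le> R\<close> by (intro mult_right_mono) auto
  finally have "real (2 * card ?h) \<le> card G"
    using \<open>0 < R\<close> by (simp add: mult_le_cancel_left)
  moreover have "card G = card {F\<in>G. F \<inter> (E - B) = {}} + card ?h"
    using assms(1) by (subst card_Un_disjoint[symmetric]) (auto intro: arg_cong[where f = card])
  ultimately show ?thesis by linarith
next
  case True
  then have "{F\<in>G. F \<inter> (E - B) = {}} = G" by auto
  then show ?thesis by simp
qed

text \<open>First discard the members that meet the other core outside their own; by
  \<open>card_not_hitting\<close> at least half of each family stays, which is the loss that
  \<open>spread_over_disjoint\<close> tolerates. Members disjoint outside their cores can then meet
  only in \<open>B1 \<inter> B2\<close>.\<close>

lemma spread_over_cross: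
  assumes X: "finite X" and G: "G1 \<subseteq> Pow X" "G2 \<subseteq> Pow X" "G1 \<noteq> {}" "G2 \<noteq> {}"
    and B: "\<And>F. F \<in> G1 \<Longrightarrow> B1 \<subseteq> F" "\<And>F. F \<in> G2 \<Longrightarrow> B2 \<subseteq> F"
    and k: "\<And>F. F \<in> G1 \<union> G2 \<Longrightarrow> card F \<le> k" "k < 2 ^ l" "0 < l"
    and spread: "spread_over R (card G1) B1 G1" "spread_over R (card G2) B2 G2"
    and R: "2 * real (card B1) \<le> R" "2 * real (card B2) \<le> R" "32 * real l \<le> R"
  shows "\<exists>F1\<in>G1. \<exists>F2\<in>G2. F1 \<inter> F2 \<subseteq> B1 \<inter> B2"
proof -
  define H1 where "H1 = {F\<in>G1. F \<inter> (B2 - B1) = {}}"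
  define H2 where "H2 = {F\<in>G2. F \<inter> (B1 - B2) = {}}"
  have fin: "finite G1" "finite G2"
    using X G(1,2) by (auto intro: finite_subset)
  have "B1 \<subseteq> X" "B2 \<subseteq> X"
    using G B by blast+
  then have finB: "finite B1" "finite B2"
    using X finite_subset by auto
  have "0 \<le> R" using R by auto
  have "card G1 \<le> 2 * card H1" "card G2 \<le> 2 * card H2"
    unfolding H1_def H2_def
    using card_not_hitting[OF fin(1) finB(2) B(1) spread(1) R(2)]
      card_not_hitting[OF fin(2) finB(1) B(2) spread(2) R(1)] by auto
  then have "real (card G1) \<le> 2 * real (card H1)" "real (card G2) \<le> 2 * real (card H2)"
    by linarith+
  moreover have "0 < real (card G1)" "0 < real (card G2)"
    using fin G by (auto simp: card_gt_0_iff)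
  moreover have "H1 \<subseteq> G1" "H2 \<subseteq> G2"
    unfolding H1_def H2_def by auto
  moreover have "spread_over R (card G1) B1 H1" "spread_over R (card G2) B2 H2"
    using spread_over_mono[OF spread(1) fin(1) \<open>H1 \<subseteq> G1\<close> \<open>0 \<le> R\<close>]
      spread_over_mono[OF spread(2) fin(2) \<open>H2 \<subseteq> G2\<close> \<open>0 \<le> R\<close>] by auto
  ultimately have "\<exists>F1\<in>H1. \<exists>F2\<in>H2. (F1 - B1) \<inter> (F2 - B2) = {}"
    using G k by (intro spread_over_disjoint[OF X _ _ _ _ _ k(2,3) _ _ _ _ _ _ R(3)]) (auto dest: B)
  then obtain F1 F2 where F: "F1 \<in> G1" "F2 \<in> G2" "F1 \<inter> (B2 - B1) = {}" "F2 \<inter> (B1 - B2) = {}"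
    "(F1 - B1) \<inter> (F2 - B2) = {}"
    unfolding H1_def H2_def by auto
  have "F1 \<inter> F2 \<subseteq> B1 \<inter> B2"
    using F(3-5) by blast
  then show ?thesis
    using F(1,2) by blast
qed

text \<open>Take \<open>B\<close> maximal with \<open>card H \<le> R ^ card (B - Y) * card (star H B)\<close>.\<close>

lemma spread_core:
  fixes R :: real
  assumes H: "finite H" "H \<noteq> {}" "\<And>F. F \<in> H \<Longrightarrow> finite F" and Y: "\<And>F. F \<in> H \<Longrightarrow> Y \<subseteq> F" and "0 < R"
  obtains B where "Y \<subseteq> B" "star H B \<noteq> {}" "card H \<le> R ^ card (B - Y) * card (star H B)"
    "spread_over R (card (star H B)) B (star H B)"
proof -
  \<comment> \<open>Requiring a member above \<open>B\<close> keeps the candidates inside the finite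
    set \<open>Pow (\<Union>H)\<close>.\<close>
  define \<B> where "\<B> = {B. Y \<subseteq> B \<and> (\<exists>F\<in>H. B \<subseteq> F) \<and> card H \<le> R ^ card (B - Y) * card (star H B)}"
  have "\<B> \<subseteq> Pow (\<Union>H)"
    unfolding \<B>_def by blast
  moreover have "finite (Pow (\<Union>H))"
    using H by auto
  ultimately have "finite \<B>"
    by (rule finite_subset)
  moreover have "star H Y = H"
    using Y unfolding star_def by auto
  then have "Y \<in> \<B>"
    using H(2) Y unfolding \<B>_def by auto
  ultimately obtain B where B: "B \<in> \<B>" and max: "\<And>Z. Z \<in> \<B> \<Longrightarrow> B \<subseteq> Z \<Longrightarrow> B = Z"
    using finite_has_maximal[of \<B>] by blast
  have "spread_over R (card (star H B)) B (star H B)"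
    unfolding spread_over_def
  proof safe
    fix Z assume "B \<subseteq> Z"
    show "R ^ card (Z - B) * real (card (star (star H B) Z)) \<le> real (card (star H B))"
    proof (cases "Z = B \<or> star H Z = {}")
      case True
      then show ?thesis by (auto simp: star_star[OF \<open>B \<subseteq> Z\<close>])
    next
      case False
      then obtain F where F: "F \<in> H" "Z \<subseteq> F"
        unfolding star_def by auto
      then have "finite Z"
        using H(3) finite_subset by blast
      have "Y \<subseteq> B" using B unfolding \<B>_def by auto
      \<comment> \<open>By maximality the defining inequality fails for \<open>Z\<close>; compared
        with the one for \<open>B\<close>, this is spreadness at \<open>Z\<close>.\<close>
      have "Z \<notin> \<B>"
        using max[OF _ \<open>B \<subseteq> Z\<close>] False by auto
      then have less: "R ^ card (Z - Y) * card (star H Z) < card H"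
        using F \<open>Y \<subseteq> B\<close> \<open>B \<subseteq> Z\<close> unfolding \<B>_def by (auto simp: not_le)
      have "Z - Y = (B - Y) \<union> (Z - B)" "(B - Y) \<inter> (Z - B) = {}" "finite B"
        using \<open>Y \<subseteq> B\<close> \<open>B \<subseteq> Z\<close> \<open>finite Z\<close> finite_subset by auto
      then have "card (Z - Y) = card (B - Y) + card (Z - B)"
        using \<open>finite Z\<close> by (metis card_Un_disjoint finite_Diff)
      then have "R ^ card (B - Y) * (R ^ card (Z - B) * card (star H Z)) < card H"
        using less by (simp add: power_add mult_ac)
      also have "\<dots> \<le> R ^ card (B - Y) * card (star H B)"
        using B unfolding \<B>_def by auto
      finally show ?thesis
        using \<open>0 < R\<close> by (simp add: star_star[OF \<open>B \<subseteq> Z\<close>])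
    qed
  qed
  then show ?thesis
    using B by (intro that[of B]) (auto simp: \<B>_def star_def)
qed

section \<open>Complexes with large maximal faces\<close>

text \<open>This form of the hypothesis on maximal faces survives the deletion of points: a large
  face \<open>M\<close> becomes \<open>M - Y\<close>, and the maximal faces of the smaller complex
  need not be determined.\<close>

definition deep :: "nat \<Rightarrow> 'a set set \<Rightarrow> bool" where
  "deep n \<C> \<longleftrightarrow> hereditary \<C> \<and> (\<forall>A\<in>\<C>. \<exists>M\<in>\<C>. A \<subseteq> M \<and> n \<le> card M)"

lemma deep_subset: "deep n \<C> \<Longrightarrow> A \<in> \<C> \<Longrightarrow> B \<subseteq> A \<Longrightarrow> B \<in> \<C>"
  unfolding deep_def hereditary_def by simp

lemma deep_if_maximal:
  assumes "finite \<C>" "hereditary \<C>" "\<And>M. inclusion_maximal \<C> M \<Longrightarrow> n \<le> card M"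
  shows "deep n \<C>"
proof -
  have "\<exists>M\<in>\<C>. A \<subseteq> M \<and> n \<le> card M" if A: "A \<in> \<C>" for A
  proof -
    obtain M where "M \<in> \<C>" "A \<subseteq> M" "\<And>Z. Z \<in> \<C> \<Longrightarrow> M \<subseteq> Z \<Longrightarrow> M = Z"
      using finite_has_maximal2[OF assms(1) A] by metis
    then show ?thesis
      using assms(3)[of M] unfolding inclusion_maximal_def by blast
  qed
  then show ?thesis
    using assms(2) unfolding deep_def by blast
qed

lemma deep_avoiding:
  assumes "deep n \<C>" "finite Y"
  shows "deep (n - card Y) {F\<in>\<C>. F \<inter> Y = {}}"
  unfolding deep_def
proof (intro conjI ballI)
  show "hereditary {F\<in>\<C>. F \<inter> Y = {}}"
    using assms(1) unfolding deep_def hereditary_def by blast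
  fix A assume A: "A \<in> {F\<in>\<C>. F \<inter> Y = {}}"
  then obtain M where M: "M \<in> \<C>" "A \<subseteq> M" "n \<le> card M"
    using assms(1) unfolding deep_def by auto
  have "M - Y \<in> \<C>"
    using deep_subset[OF assms(1) M(1)] by auto
  moreover have "n - card Y \<le> card (M - Y)"
    using diff_card_le_card_Diff[OF assms(2), of M] M(3) by linarith
  ultimately show "\<exists>M\<in>{F\<in>\<C>. F \<inter> Y = {}}. A \<subseteq> M \<and> n - card Y \<le> card M"
    using M A by (intro bexI[of _ "M - Y"]) auto
qed

text \<open>Double counting of the exchanges that replace \<open>x\<close> by an element \<open>y\<close> of a large face
  containing the set.\<close>

lemma card_star_insert:
  assumes V: "finite V" "\<C> \<subseteq> Pow V" and "deep n \<C>" and "x \<notin> X" and "0 < k"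
  shows "(n - k) * card (star (layer \<C> k) (insert x X)) \<le> k * card (star (layer \<C> k) X)"
proof -
  obtain M where M: "\<And>F. F \<in> \<C> \<Longrightarrow> M F \<in> \<C> \<and> F \<subseteq> M F \<and> n \<le> card (M F)"
    using assms(3) unfolding deep_def by metis
  let ?A = "star (layer \<C> k) (insert x X)" and ?B = "star (layer \<C> k) X"
  \<comment> \<open>Keeping \<open>y\<close> makes the exchange reversible, and a set in
    \<open>?B\<close> is reached with at most \<open>k\<close> different \<open>y\<close>.\<close>
  define g where "g = (\<lambda>(F, y). (insert y (F - {x}), y))"
  have finV: "finite F" if "F \<in> \<C>" for F
    using that V by (auto intro: finite_subset)
  have "finite \<C>"
    using V finite_subset by auto
  then have fin: "finite ?A" "finite ?B"
    unfolding star_def layer_def by auto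
  have inj: "inj_on g (Sigma ?A (\<lambda>F. M F - F))"
  proof (rule inj_onI)
    fix p p' assume p: "p \<in> Sigma ?A (\<lambda>F. M F - F)" and p': "p' \<in> Sigma ?A (\<lambda>F. M F - F)" and eq: "g p = g p'"
    obtain F F' y where F: "p = (F, y)" "p' = (F', y)" "insert y (F - {x}) = insert y (F' - {x})"
      using eq unfolding g_def by (cases p, cases p') auto
    have "x \<in> F" "y \<notin> F" "x \<in> F'" "y \<notin> F'"
      using p p' unfolding F star_def by auto
    then have "F = insert x (insert y (F - {x}) - {y})" "F' = insert x (insert y (F' - {x}) - {y})"
      by auto
    then have "F = F'"
      using F(3) by simp
    then show "p = p'" using F by simp
  qed
  have sub: "g ` Sigma ?A (\<lambda>F. M F - F) \<subseteq> Sigma ?B (\<lambda>G. G)"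
  proof
    fix z assume "z \<in> g ` Sigma ?A (\<lambda>F. M F - F)"
    then obtain F y where z: "z = (insert y (F - {x}), y)" and F: "F \<in> ?A" and y: "y \<in> M F" "y \<notin> F"
      unfolding g_def by auto
    have FC: "F \<in> \<C>" "finite F" "card F = k" "x \<in> F" "X \<subseteq> F"
      using F unfolding star_def layer_def by auto
    have "insert y (F - {x}) \<subseteq> M F"
      using M[OF FC(1)] y by auto
    then have "insert y (F - {x}) \<in> \<C>"
      using M[OF FC(1)] deep_subset[OF assms(3)] by auto
    moreover have "card (insert y (F - {x})) = k"
      using FC y \<open>0 < k\<close> by simp
    moreover have "X \<subseteq> insert y (F - {x})"
      using FC(5) \<open>x \<notin> X\<close> by auto
    ultimately show "z \<in> Sigma ?B (\<lambda>G. G)"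
      using FC(2) unfolding z star_def layer_def by auto
  qed
  have "(n - k) * card ?A = (\<Sum>F\<in>?A. n - k)"
    by simp
  also have "\<dots> \<le> (\<Sum>F\<in>?A. card (M F - F))"
  proof (intro sum_mono)
    fix F assume "F \<in> ?A"
    then have "F \<in> \<C>" "card F = k" unfolding star_def layer_def by auto
    then show "n - k \<le> card (M F - F)"
      using M[of F] diff_card_le_card_Diff[OF finV, of F "M F"] by fastforce
  qed
  also have "\<dots> = card (Sigma ?A (\<lambda>F. M F - F))"
    using fin M finV by (intro card_SigmaI[symmetric]) (auto simp: star_def layer_def)
  also have "\<dots> = card (g ` Sigma ?A (\<lambda>F. M F - F))"
    using card_image[OF inj] by simp
  also have "\<dots> \<le> card (Sigma ?B (\<lambda>G. G))"
    using fin sub by (intro card_mono finite_SigmaI) (auto simp: star_def layer_def)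
  also have "\<dots> = (\<Sum>G\<in>?B. card G)"
    using fin by (intro card_SigmaI) (auto simp: star_def layer_def)
  also have "\<dots> = k * card ?B"
    by (simp add: star_def layer_def)
  finally show ?thesis .
qed

lemma card_star_insert_real:
  assumes "finite V" "\<C> \<subseteq> Pow V" "deep n \<C>" "x \<notin> X" "0 < k" "r * real k \<le> real n - real k"
  shows "r * card (star (layer \<C> k) (insert x X)) \<le> card (star (layer \<C> k) X)"
proof -
  let ?a = "real (card (star (layer \<C> k) (insert x X)))" and ?b = "real (card (star (layer \<C> k) X))"
  have "real k * (r * ?a) \<le> (real n - real k) * ?a"
    using mult_right_mono[OF assms(6), of ?a] by (simp add: mult_ac)
  also have "\<dots> \<le> real (n - k) * ?a"
    by (intro mult_right_mono) linarith+
  also have "\<dots> \<le> real k * ?b"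
    using card_star_insert[OF assms(1-5)] by (metis of_nat_le_iff of_nat_mult)
  finally show ?thesis
    using \<open>0 < k\<close> by simp
qed

text \<open>Add the points of \<open>Z - X\<close> one at a time; each exchange step gains a factor
  \<open>r\<close>. No member contains an infinite \<open>Z\<close>.\<close>

lemma spread_over_layer:
  assumes V: "finite V" "\<C> \<subseteq> Pow V" and "deep n \<C>" "0 < k" and r: "0 \<le> r" "r * real k \<le> real n - real k"
  shows "spread_over r (card (star (layer \<C> k) X)) X (star (layer \<C> k) X)"
  unfolding spread_over_def
proof safe
  fix Z assume "X \<subseteq> Z"
  have *: "r ^ card E * card (star (layer \<C> k) (X \<union> E)) \<le> card (star (layer \<C> k) X)" if "finite E" "E \<inter> X = {}" for E
    using that
  proof (induction E)
    case (insert x E)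
    have "x \<notin> X \<union> E" using insert by auto
    note step = card_star_insert_real[OF assms(1-3) this assms(4,6)]
    have "r ^ card (insert x E) * real (card (star (layer \<C> k) (X \<union> insert x E)))
        = r ^ card E * (r * card (star (layer \<C> k) (insert x (X \<union> E))))"
      using insert by (simp add: mult_ac)
    also have "\<dots> \<le> r ^ card E * card (star (layer \<C> k) (X \<union> E))"
      using step r by (intro mult_left_mono) auto
    also have "\<dots> \<le> card (star (layer \<C> k) X)"
      using insert by auto
    finally show ?case .
  qed simp
  have "r ^ card (Z - X) * card (star (layer \<C> k) Z) \<le> card (star (layer \<C> k) X)"
  proof (cases "finite Z")
    case True
    then show ?thesis
      using *[of "Z - X"] \<open>X \<subseteq> Z\<close> by (auto simp: Un_absorb1)
  next
    case False
    then have "star (layer \<C> k) Z = {}"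
      using finite_subset unfolding star_def layer_def by auto
    then show ?thesis by simp
  qed
  then show "r ^ card (Z - X) * card (star (star (layer \<C> k) X) Z) \<le> card (star (layer \<C> k) X)"
    by (simp add: star_star[OF \<open>X \<subseteq> Z\<close>])
qed

text \<open>Delete the points of \<open>Y\<close> one at a time. What remains is still deep, with
  \<open>n\<close> lowered by the number of deleted points, so at most a fraction
  \<open>1 / r\<close> of the current star contains the next point.\<close>

lemma card_star_avoiding:
  assumes V: "finite V" "\<C> \<subseteq> Pow V" and "deep n \<C>" "0 < k" "1 \<le> r" and "finite Y" "Y \<inter> X = {}"
    and r: "r * real k \<le> real n - real (card Y) - real k"
  shows "(1 - 1 / r) ^ card Y * card (star (layer \<C> k) X)
    \<le> card (star (layer {F\<in>\<C>. F \<inter> Y = {}} k) X)"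
  using assms(6-8)
proof (induction Y)
  case (insert y Y)
  define \<D> where "\<D> = {F\<in>\<C>. F \<inter> Y = {}}"
  have \<D>: "finite V" "\<D> \<subseteq> Pow V" "deep (n - card Y) \<D>"
    using V deep_avoiding[OF assms(3) \<open>finite Y\<close>] unfolding \<D>_def by auto
  have "finite \<D>"
    using \<D>(1,2) finite_subset by auto
  have "y \<notin> X" using insert by auto
  have "0 < r" "0 \<le> 1 - 1 / r" using assms(5) by auto
  have "r * real k \<le> real (n - card Y) - real k"
    using insert by auto
  from card_star_insert_real[OF \<D> \<open>y \<notin> X\<close> assms(4) this]
  have step: "card (star (layer \<D> k) (insert y X)) \<le> 1 / r * card (star (layer \<D> k) X)"
    using \<open>0 < r\<close> by (simp add: field_simps)
  have "star (layer \<D> k) X = star (layer {F\<in>\<C>. F \<inter> insert y Y = {}} k) X \<union> star (layer \<D> k) (insert y X)"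
    "star (layer {F\<in>\<C>. F \<inter> insert y Y = {}} k) X \<inter> star (layer \<D> k) (insert y X) = {}"
    unfolding \<D>_def star_def layer_def by auto
  moreover have "finite (star (layer \<D> k) X)"
    using \<open>finite \<D>\<close> unfolding star_def layer_def by auto
  ultimately have card: "card (star (layer \<D> k) X)
      = card (star (layer {F\<in>\<C>. F \<inter> insert y Y = {}} k) X) + card (star (layer \<D> k) (insert y X))"
    by (metis card_Un_disjoint finite_Un)
  have "(1 - 1 / r) ^ card (insert y Y) * real (card (star (layer \<C> k) X))
      = (1 - 1 / r) * ((1 - 1 / r) ^ card Y * card (star (layer \<C> k) X))"
    using insert by simp
  also have "\<dots> \<le> (1 - 1 / r) * card (star (layer \<D> k) X)"
    using insert \<open>0 \<le> 1 - 1 / r\<close> unfolding \<D>_def by (intro mult_left_mono) auto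
  also have "\<dots> \<le> card (star (layer {F\<in>\<C>. F \<inter> insert y Y = {}} k) X)"
    using step card by (simp add: algebra_simps)
  finally show ?case .
qed simp

section \<open>Covering by t-intersecting families\<close>

text \<open>Record \<open>F\<close> by its trace on \<open>F1 \<union> F2\<close>, where \<open>F1 \<inter> F2\<close> is as small as possible: if \<open>F\<close> misses
  \<open>j\<close> points of \<open>F1 \<inter> F2\<close>, then it meets \<open>F1 - F2\<close> and \<open>F2 - F1\<close> in at least \<open>j\<close> points each, so the
  trace has at least \<open>t + j\<close> elements. This makes up for the choice of the \<open>j\<close> missing points.\<close>

lemma card_uniform_t_intersecting:
  fixes \<alpha> :: real
  assumes W: "finite W" "\<And>F. F \<in> W \<Longrightarrow> finite F" "\<And>F. F \<in> W \<Longrightarrow> card F = t + s"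
    and int: "t_intersecting t W"
    and star: "\<And>Y. star W Y \<noteq> {} \<Longrightarrow> card (star W Y) \<le> \<alpha> ^ (t + s - card Y)"
    and \<alpha>: "real (t + s) \<le> \<alpha>" "1 \<le> \<alpha>"
  shows "card W \<le> (8 * \<alpha>) ^ s"
proof (cases "W = {}")
  case False
  define c where "c = (LEAST c. \<exists>F1\<in>W. \<exists>F2\<in>W. card (F1 \<inter> F2) = c)"
  have ex: "\<exists>c. \<exists>F1\<in>W. \<exists>F2\<in>W. card (F1 \<inter> F2) = c"
    using False by auto
  obtain F1 F2 where F: "F1 \<in> W" "F2 \<in> W" "card (F1 \<inter> F2) = c"
    using LeastI_ex[OF ex] unfolding c_def[symmetric] by auto
  have least: "c \<le> card (F \<inter> F')" if "F \<in> W" "F' \<in> W" for F F'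
    unfolding c_def using that by (intro Least_le) auto
  have "t \<le> c"
    using int F unfolding t_intersecting_def by auto
  define I where "I = F1 \<inter> F2"
  define \<Delta> where "\<Delta> = (F1 - F2) \<union> (F2 - F1)"
  define \<J> where "\<J> = {J\<in>Pow I. card J \<le> s}"
  define \<K> where "\<K> J = {K\<in>Pow \<Delta>. 2 * card J \<le> card K}" for J :: "'a set"
  have fin: "finite F1" "finite F2" "finite I" "finite \<Delta>"
    using W F unfolding I_def \<Delta>_def by auto
  have fin2: "finite \<J>" "\<And>J. finite (\<K> J)"
    using fin unfolding \<J>_def \<K>_def by auto
  have card_diff: "card (F1 - F2) = t + s - c" "card (F2 - F1) = t + s - c"
    using F W(3) card_Diff_subset_Int[of F1 F2] card_Diff_subset_Int[of F2 F1] fin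
    by (auto simp: I_def Int_commute)
  have card\<Delta>: "card \<Delta> \<le> 2 * s"
    using card_Un_le[of "F1 - F2" "F2 - F1"] card_diff \<open>t \<le> c\<close> unfolding \<Delta>_def by linarith
  have cover: "W \<subseteq> (\<Union>J\<in>\<J>. \<Union>K\<in>\<K> J. star W ((I - J) \<union> K))"
  proof
    fix F assume "F \<in> W"
    then have "finite F" using W by auto
    have part: "card (I - F) \<le> card (F \<inter> (G - I))" if "G = F1 \<or> G = F2" for G
    proof -
      have "card (I - F) + card (I \<inter> F) = c"
        using card_Diff_subset_Int[of I F] card_mono[OF fin(3) Int_lower1[of I F]] fin(3) F(3)[folded I_def]
        by simp
      moreover have "c \<le> card (F \<inter> G)"
        using least \<open>F \<in> W\<close> F that by auto
      moreover have "F \<inter> G = (I \<inter> F) \<union> (F \<inter> (G - I))" "(I \<inter> F) \<inter> (F \<inter> (G - I)) = {}"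
        using that unfolding I_def by auto
      then have "card (F \<inter> G) = card (I \<inter> F) + card (F \<inter> (G - I))"
        using \<open>finite F\<close> by (metis card_Un_disjoint finite_Int)
      ultimately show ?thesis by linarith
    qed
    have D: "F1 - I = F1 - F2" "F2 - I = F2 - F1"
      unfolding I_def by auto
    have "card (I - F) \<le> card (F \<inter> (F1 - F2))" "card (I - F) \<le> card (F \<inter> (F2 - F1))"
      using part[of F1] part[of F2] D by auto
    moreover have "F \<inter> \<Delta> = (F \<inter> (F1 - F2)) \<union> (F \<inter> (F2 - F1))" "(F \<inter> (F1 - F2)) \<inter> (F \<inter> (F2 - F1)) = {}"
      unfolding \<Delta>_def by auto
    then have "card (F \<inter> \<Delta>) = card (F \<inter> (F1 - F2)) + card (F \<inter> (F2 - F1))"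
      using \<open>finite F\<close> by (metis card_Un_disjoint finite_Int)
    moreover have "card (F \<inter> (F1 - F2)) \<le> card (F1 - F2)"
      using fin by (intro card_mono) auto
    ultimately have "I - F \<in> \<J>" "F \<inter> \<Delta> \<in> \<K> (I - F)"
      using card_diff \<open>t \<le> c\<close> unfolding \<J>_def \<K>_def by auto
    moreover have "F \<in> star W ((I - (I - F)) \<union> (F \<inter> \<Delta>))"
      using \<open>F \<in> W\<close> unfolding star_def by auto
    ultimately show "F \<in> (\<Union>J\<in>\<J>. \<Union>K\<in>\<K> J. star W ((I - J) \<union> K))"
      by blast
  qed
  have one: "card (star W ((I - J) \<union> K)) \<le> \<alpha> ^ (s - card J)" if "J \<in> \<J>" "K \<in> \<K> J" for J K
  proof (cases "star W ((I - J) \<union> K) = {}")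
    case True
    then show ?thesis using \<alpha> by simp
  next
    case False
    have "finite J" "J \<subseteq> I" "K \<subseteq> \<Delta>" "2 * card J \<le> card K"
      using that fin unfolding \<J>_def \<K>_def by (auto intro: finite_subset)
    moreover have "(I - J) \<inter> K = {}"
      using \<open>K \<subseteq> \<Delta>\<close> unfolding I_def \<Delta>_def by auto
    moreover have "finite K"
      using \<open>K \<subseteq> \<Delta>\<close> fin finite_subset by auto
    ultimately have "card ((I - J) \<union> K) = card I - card J + card K"
      using fin by (simp add: card_Un_disjoint card_Diff_subset)
    moreover have "card I = c" using F(3) unfolding I_def .
    ultimately have "t + s - card ((I - J) \<union> K) \<le> s - card J"
      using \<open>t \<le> c\<close> \<open>2 * card J \<le> card K\<close> by linarith
    then have "\<alpha> ^ (t + s - card ((I - J) \<union> K)) \<le> \<alpha> ^ (s - card J)"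
      using \<alpha> by (intro power_increasing) auto
    then show ?thesis
      using star[OF False] by linarith
  qed
  have "card W \<le> card (\<Union>J\<in>\<J>. \<Union>K\<in>\<K> J. star W ((I - J) \<union> K))"
    using cover fin2 W by (intro card_mono finite_UN_I finite_star) auto
  also have "\<dots> \<le> (\<Sum>J\<in>\<J>. card (\<Union>K\<in>\<K> J. star W ((I - J) \<union> K)))"
    by (intro card_UN_le fin2)
  also have "\<dots> \<le> (\<Sum>J\<in>\<J>. \<Sum>K\<in>\<K> J. card (star W ((I - J) \<union> K)))"
    by (intro sum_mono card_UN_le fin2)
  finally have "real (card W) \<le> real (\<Sum>J\<in>\<J>. \<Sum>K\<in>\<K> J. card (star W ((I - J) \<union> K)))"
    unfolding of_nat_le_iff .
  also have "\<dots> = (\<Sum>J\<in>\<J>. \<Sum>K\<in>\<K> J. real (card (star W ((I - J) \<union> K))))"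
    by simp
  also have "\<dots> \<le> (\<Sum>J\<in>\<J>. \<Sum>K\<in>\<K> J. \<alpha> ^ (s - card J))"
    by (intro sum_mono one)
  also have "\<dots> \<le> (\<Sum>J\<in>\<J>. 4 ^ s * \<alpha> ^ (s - card J))"
  proof (intro sum_mono)
    fix J
    have "card (\<K> J) \<le> card (Pow \<Delta>)"
      using fin unfolding \<K>_def by (intro card_mono) auto
    also have "\<dots> \<le> 2 ^ (2 * s)"
      using fin card\<Delta> by (simp add: card_Pow)
    finally have "real (card (\<K> J)) \<le> 4 ^ s"
      by (simp add: power_mult)
    then show "(\<Sum>K\<in>\<K> J. \<alpha> ^ (s - card J)) \<le> 4 ^ s * \<alpha> ^ (s - card J)"
      using \<alpha> by (simp add: mult_right_mono)
  qed
  \<comment> \<open>Group by \<open>j = card J\<close>: the at most \<open>\<alpha> ^ j\<close>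
    choices of \<open>J\<close> make up exactly for the missing power of \<open>\<alpha>\<close>, so
    each of the \<open>s + 1\<close> sizes contributes at most \<open>\<alpha> ^ s\<close>.\<close>
  also have "\<dots> = 4 ^ s * (\<Sum>j\<in>{..s}. \<Sum>J\<in>{J\<in>\<J>. card J = j}. \<alpha> ^ (s - card J))"
    unfolding sum_distrib_left[symmetric] using fin2
    by (subst sum.group[of \<J> "{..s}" card]) (auto simp: \<J>_def)
  also have "\<dots> \<le> 4 ^ s * (\<Sum>j\<in>{..s}. \<alpha> ^ s)"
  proof (intro mult_left_mono sum_mono)
    fix j assume "j \<in> {..s}"
    have "{J\<in>\<J>. card J = j} \<subseteq> {J. J \<subseteq> I \<and> card J = j}"
      unfolding \<J>_def by auto
    moreover have "finite {J. J \<subseteq> I \<and> card J = j}"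
      using fin(3) by simp
    ultimately have "card {J\<in>\<J>. card J = j} \<le> card {J. J \<subseteq> I \<and> card J = j}"
      by (intro card_mono)
    also have "\<dots> = card I choose j"
      by (rule n_subsets[OF fin(3)])
    also have "\<dots> \<le> card I ^ j"
      by (cases "j \<le> card I") (auto simp: binomial_le_pow binomial_eq_0)
    finally have "real (card {J\<in>\<J>. card J = j}) \<le> real (card I) ^ j"
      by (metis of_nat_le_iff of_nat_power)
    also have "card I \<le> card F1"
      using fin unfolding I_def by (intro card_mono) auto
    then have "real (card I) ^ j \<le> \<alpha> ^ j"
      using W(3)[OF F(1)] \<alpha> by (intro power_mono) auto
    finally have "real (card {J\<in>\<J>. card J = j}) * \<alpha> ^ (s - j) \<le> \<alpha> ^ j * \<alpha> ^ (s - j)"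
      using \<alpha> by (intro mult_right_mono) auto
    also have "\<dots> = \<alpha> ^ s"
      using \<open>j \<in> {..s}\<close> by (simp flip: power_add)
    finally show "(\<Sum>J\<in>{J\<in>\<J>. card J = j}. \<alpha> ^ (s - card J)) \<le> \<alpha> ^ s"
      by simp
  qed simp
  also have "\<dots> = 4 ^ s * real (s + 1) * \<alpha> ^ s"
    by simp
  also have "\<dots> \<le> 4 ^ s * 2 ^ s * \<alpha> ^ s"
  proof (intro mult_right_mono mult_left_mono)
    have "s + 1 \<le> 2 ^ s"
      using less_exp[of s] by linarith
    then show "real (s + 1) \<le> 2 ^ s"
      by (metis of_nat_le_iff of_nat_numeral of_nat_power)
  qed (use \<alpha> in auto)
  also have "\<dots> = (8 * \<alpha>) ^ s"
    unfolding power_mult_distrib[symmetric] by simp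
  finally show ?thesis .
qed (use \<alpha> in simp)

lemma sum_powers_le:
  fixes z :: real
  assumes "0 \<le> z" "z \<le> 1 / 2"
  shows "(\<Sum>i\<in>{1..m}. z ^ i) \<le> 2 * z"
proof -
  \<comment> \<open>The extra tail term is what makes the induction close.\<close>
  have "(\<Sum>i\<in>{1..m}. z ^ i) + 2 * z ^ Suc m \<le> 2 * z"
  proof (induction m)
    case (Suc m)
    have "z * z ^ Suc m \<le> 1 / 2 * z ^ Suc m"
      using assms by (intro mult_right_mono) auto
    then show ?case using Suc by simp
  qed simp
  moreover have "0 \<le> z ^ Suc m" using assms by simp
  ultimately show ?thesis by linarith
qed

text \<open>Extend \<open>S\<close> to a maximal family \<open>U\<close>. A member of
  \<open>U\<close> of size \<open>t\<close> lies in every member of \<open>S\<close>. Otherwise all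
  minimal members have size \<open>t + i\<close> with \<open>1 \<le> i\<close>; there are at most
  \<open>(8 * \<alpha>) ^ i\<close> of them, their stars have at most \<open>L / r ^ i\<close>
  elements each, and a geometric series remains.\<close>

lemma t_intersecting_cover:
  fixes r L :: real
  assumes V: "finite V" "\<A> \<subseteq> Pow V" "S \<subseteq> Pow V" and q: "\<And>B. B \<in> S \<Longrightarrow> card B \<le> q"
    and int: "t_intersecting t S"
    and weight: "\<And>B. B \<subseteq> V \<Longrightarrow> t \<le> card B \<Longrightarrow> r ^ (card B - t) * card (star \<A> B) \<le> L"
    and r: "16 * (real q + 1) \<le> r" and "0 \<le> L"
  shows "(\<exists>T\<subseteq>V. card T = t \<and> (\<forall>B\<in>S. T \<subseteq> B)) \<or> card (\<Union>B\<in>S. star \<A> B) \<le> 16 * (real q + 1) / r * L"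
proof -
  define \<UU> where "\<UU> = {U. S \<subseteq> U \<and> U \<subseteq> {B\<in>Pow V. card B \<le> q} \<and> t_intersecting t U}"
  have "\<UU> \<subseteq> Pow (Pow V)" unfolding \<UU>_def by auto
  then have "finite \<UU>"
    using V(1) by (meson finite_Pow_iff finite_subset)
  moreover have "S \<in> \<UU>"
    using V q int unfolding \<UU>_def by auto
  ultimately obtain U where U: "U \<in> \<UU>" and maxU: "\<And>U'. U' \<in> \<UU> \<Longrightarrow> U \<subseteq> U' \<Longrightarrow> U = U'"
    using finite_has_maximal[of \<UU>] by blast
  have US: "S \<subseteq> U" and UV: "\<And>B. B \<in> U \<Longrightarrow> B \<subseteq> V \<and> card B \<le> q"
    and Ut: "\<And>B B'. B \<in> U \<Longrightarrow> B' \<in> U \<Longrightarrow> t \<le> card (B \<inter> B')"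
    using U unfolding \<UU>_def t_intersecting_def by auto
  have finU: "finite U"
    using UV V(1) by (intro finite_subset[of U "Pow V"]) auto
  have finB: "finite B" if "B \<in> U" for B
    using UV[OF that] V(1) finite_subset by auto
  define \<M> where "\<M> = {B\<in>U. \<forall>B'\<in>U. B' \<subseteq> B \<longrightarrow> B' = B}"
  define W where "W i = {B\<in>\<M>. card B = t + i}" for i
  \<comment> \<open>Strictly above the size of every member \<open>B\<close> of \<open>U\<close>, so
    that in a family spread around \<open>X\<close> with this parameter some member avoids
    \<open>B - X\<close>.\<close>
  define \<alpha> where "\<alpha> = real q + 1"
  have \<alpha>: "1 \<le> \<alpha>" unfolding \<alpha>_def by simp
  have WU: "W i \<subseteq> U" for i
    unfolding W_def \<M>_def by auto
  have finW: "finite (W i)" for i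
    by (rule finite_subset[OF WU finU])
  \<comment> \<open>The spread core \<open>X\<close> of the members containing \<open>Y\<close>
    meets every set in \<open>U\<close> in at least \<open>t\<close> points, so maximality of
    \<open>U\<close> gives \<open>X \<in> U\<close>. Minimality of the members of
    \<open>\<M>\<close> then leaves \<open>G = {X}\<close>, and only the power of
    \<open>\<alpha>\<close> from \<open>spread_core\<close> survives.\<close>
  have starW: "card (star (W i) Y) \<le> \<alpha> ^ (t + i - card Y)" if ne: "star (W i) Y \<noteq> {}" for i Y
  proof -
    have 1: "finite (star (W i) Y)" using finW by (rule finite_star)
    have 2: "\<And>F. F \<in> star (W i) Y \<Longrightarrow> finite F"
      using finB WU unfolding star_def by auto
    have 3: "\<And>F. F \<in> star (W i) Y \<Longrightarrow> Y \<subseteq> F"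
      unfolding star_def by auto
    have 4: "0 < \<alpha>" using \<alpha> by simp
    obtain X where X: "Y \<subseteq> X" "star (star (W i) Y) X \<noteq> {}"
      "card (star (W i) Y) \<le> \<alpha> ^ card (X - Y) * card (star (star (W i) Y) X)"
      "spread_over \<alpha> (card (star (star (W i) Y) X)) X (star (star (W i) Y) X)"
      by (rule spread_core[OF 1 ne 2 3 4])
    define G where "G = star (W i) X"
    have G: "G \<noteq> {}" "card (star (W i) Y) \<le> \<alpha> ^ card (X - Y) * card G" "spread_over \<alpha> (card G) X G"
      using X unfolding G_def star_star[OF X(1)] by auto
    have finG: "finite G" unfolding G_def using finW by (rule finite_star)
    have GX: "F \<in> W i" "X \<subseteq> F" if "F \<in> G" for F
      using that unfolding G_def star_def by auto
    have "t \<le> card (X \<inter> B)" if "B \<in> U" for B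
    proof -
      have "\<alpha> * card {F\<in>G. F \<inter> (B - X) \<noteq> {}} \<le> card (B - X) * real (card G)"
        using card_hitting[OF finG finB[OF that] GX(2) G(3)] \<alpha> by simp
      also have "\<dots> < \<alpha> * card G"
      proof (intro mult_strict_right_mono)
        have "card (B - X) \<le> card B"
          using finB[OF that] by (intro card_mono) auto
        then show "real (card (B - X)) < \<alpha>"
          using UV[OF that] unfolding \<alpha>_def by auto
        show "0 < real (card G)"
          using finG G(1) by (simp add: card_gt_0_iff)
      qed
      finally have "card {F\<in>G. F \<inter> (B - X) \<noteq> {}} < card G"
        using \<alpha> by simp
      then have "{F\<in>G. F \<inter> (B - X) \<noteq> {}} \<noteq> G"
        by (rule contrapos_pn) simp
      then obtain F where F: "F \<in> G" "F \<inter> (B - X) = {}"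
        by blast
      have "t \<le> card (F \<inter> B)"
        using Ut[of F B] GX(1)[OF F(1)] WU that by auto
      also have "\<dots> \<le> card (X \<inter> B)"
        using F(2) finB[OF that] by (intro card_mono) auto
      finally show ?thesis .
    qed
    note XU = this
    obtain F where F: "F \<in> G" using G(1) by auto
    have FW: "F \<in> W i" "X \<subseteq> F" using GX[OF F] .
    then have FU: "F \<in> U" "finite F" using WU finB by auto
    have "finite X" using FW FU finite_subset by auto
    have "t \<le> card X"
      using XU[OF FU(1)] card_mono[OF \<open>finite X\<close>, of "X \<inter> F"] by auto
    moreover have "card X \<le> q"
      using card_mono[OF FU(2) FW(2)] UV[OF FU(1)] by linarith
    ultimately have "insert X U \<in> \<UU>"
      using U XU UV[OF FU(1)] FW(2) unfolding \<UU>_def t_intersecting_def by (auto simp: Int_commute)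
    then have "X \<in> U" using maxU by blast
    have eq: "F' = X" if "F' \<in> G" for F'
      using GX[OF that] \<open>X \<in> U\<close> unfolding W_def \<M>_def by auto
    then have "G = {X}" using F by blast
    moreover have "card X = t + i"
      using eq[OF F] FW(1) unfolding W_def by auto
    moreover have "card (X - Y) = card X - card Y"
      using X(1) \<open>finite X\<close> finite_subset by (intro card_Diff_subset) auto
    ultimately show ?thesis
      using G(2) by simp
  qed
  show ?thesis
  proof (cases "\<exists>T\<in>U. card T = t")
    case True
    then obtain T where T: "T \<in> U" "card T = t" by auto
    have "T \<subseteq> B" if "B \<in> S" for B
    proof -
      have "t \<le> card (T \<inter> B)" using Ut[OF T(1), of B] that US by auto
      then have "T \<inter> B = T"
        using T(2) finB[OF T(1)] by (intro card_seteq) auto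
      then show ?thesis by auto
    qed
    then show ?thesis
      using T UV by blast
  next
    case False
    have cover: "(\<Union>B\<in>S. star \<A> B) \<subseteq> (\<Union>i\<in>{1..q}. \<Union>B\<in>W i. star \<A> B)"
    proof
      fix F assume "F \<in> (\<Union>B\<in>S. star \<A> B)"
      then obtain B where B: "B \<in> U" "F \<in> star \<A> B" using US by auto
      obtain M where M: "M \<in> U" "M \<subseteq> B" "\<And>B'. B' \<in> U \<Longrightarrow> B' \<subseteq> M \<Longrightarrow> M = B'"
        using finite_has_minimal2[OF finU B(1)] by metis
      have "t \<le> card M" using Ut[OF M(1) M(1)] by simp
      moreover have "card M \<noteq> t" using False M(1) by auto
      moreover have "card M \<le> q" using UV[OF M(1)] by simp
      ultimately have "card M - t \<in> {1..q}" "card M = t + (card M - t)" by auto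
      moreover have "M \<in> \<M>" using M unfolding \<M>_def by auto
      moreover have "F \<in> star \<A> M" using B(2) M(2) unfolding star_def by auto
      ultimately show "F \<in> (\<Union>i\<in>{1..q}. \<Union>B\<in>W i. star \<A> B)"
        unfolding W_def by blast
    qed
    have fin\<A>: "finite \<A>" using V(1) by (intro finite_subset[OF V(2)]) auto
    have "card (\<Union>B\<in>S. star \<A> B) \<le> card (\<Union>i\<in>{1..q}. \<Union>B\<in>W i. star \<A> B)"
      using cover finW fin\<A> by (intro card_mono finite_UN_I finite_star) auto
    also have "\<dots> \<le> (\<Sum>i\<in>{1..q}. card (\<Union>B\<in>W i. star \<A> B))"
      by (intro card_UN_le) auto
    also have "\<dots> \<le> (\<Sum>i\<in>{1..q}. \<Sum>B\<in>W i. card (star \<A> B))"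
      by (intro sum_mono card_UN_le finW)
    finally have "real (card (\<Union>B\<in>S. star \<A> B)) \<le> real (\<Sum>i\<in>{1..q}. \<Sum>B\<in>W i. card (star \<A> B))"
      unfolding of_nat_le_iff .
    also have "\<dots> = (\<Sum>i\<in>{1..q}. \<Sum>B\<in>W i. real (card (star \<A> B)))"
      by simp
    also have "\<dots> \<le> (\<Sum>i\<in>{1..q}. (8 * \<alpha> / r) ^ i * L)"
    proof (intro sum_mono)
      fix i
      have "0 < r" by (rule less_le_trans[OF _ r]) simp
      have "(\<Sum>B\<in>W i. real (card (star \<A> B))) \<le> (\<Sum>B\<in>W i. L / r ^ i)"
      proof (intro sum_mono)
        fix B assume "B \<in> W i"
        then have "B \<subseteq> V" "card B = t + i"
          using UV WU unfolding W_def \<M>_def by auto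
        then show "real (card (star \<A> B)) \<le> L / r ^ i"
          using weight[of B] \<open>0 < r\<close> by (simp add: field_simps)
      qed
      also have "\<dots> = card (W i) * (L / r ^ i)"
        by simp
      also have "real (card (W i)) \<le> (8 * \<alpha>) ^ i"
      proof (cases "W i = {}")
        case False
        then obtain B where "B \<in> W i" by auto
        then have "B \<in> U" "card B = t + i" using WU unfolding W_def by auto
        then have "t + i \<le> q" using UV by force
        then show ?thesis
          using finW finB WU Ut starW \<alpha>
          by (intro card_uniform_t_intersecting[where t = t])
            (auto simp: W_def \<M>_def t_intersecting_def \<alpha>_def)
      qed (use \<alpha> in simp)
      then have "card (W i) * (L / r ^ i) \<le> (8 * \<alpha>) ^ i * (L / r ^ i)"
        using \<open>0 \<le> L\<close> \<open>0 < r\<close> by (intro mult_right_mono) auto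
      also have "\<dots> = (8 * \<alpha> / r) ^ i * L"
        by (simp add: power_divide)
      finally show "(\<Sum>B\<in>W i. real (card (star \<A> B))) \<le> (8 * \<alpha> / r) ^ i * L" .
    qed
    also have "\<dots> = (\<Sum>i\<in>{1..q}. (8 * \<alpha> / r) ^ i) * L"
      by (simp add: sum_distrib_right)
    also have "\<dots> \<le> 2 * (8 * \<alpha> / r) * L"
    proof (intro mult_right_mono sum_powers_le)
      have "0 < r" by (rule less_le_trans[OF _ r]) simp
      then show "0 \<le> 8 * \<alpha> / r" "8 * \<alpha> / r \<le> 1 / 2"
        using r \<alpha> unfolding \<alpha>_def by (auto simp: field_simps)
    qed (use \<open>0 \<le> L\<close> in auto)
    finally show ?thesis
      unfolding \<alpha>_def by simp
  qed
qed

section \<open>The theorem\<close>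

text \<open>The second size condition gives \<open>t * log 2 (n / k) \<le> 2 * e\<close>, which is why a cutoff \<open>q\<close> of
  about \<open>3 * e\<close> absorbs the factor \<open>r ^ t\<close>.\<close>

lemma spread_parameters:
  fixes n k t :: nat
  defines "e \<equiv> 2 powr (-20) * (real n / (real k * log 2 (real n / real k)))"
  assumes "0 < k" "0 < t"
    and n1: "2 ^ 13 * real k * log 2 (2 * real k) \<le> real n"
    and n2: "2 ^ 19 * real t * real k * (log 2 (real n / real k))\<^sup>2 \<le> real n"
  obtains q l :: nat and r :: real where
    "k < 2 ^ l" "0 < l" "32 * real l \<le> r / 4" "2 * real q \<le> r / 4" "16 * (real q + 1) \<le> r / 100"
    "1600 \<le> r" "r * real k \<le> real n - 2 * real k" "t \<le> q" "7 \<le> q" "r ^ t \<le> (2 powr e)\<^sup>2" "3 * e + 3 \<le> real q" "0 \<le> e"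
proof -
  define \<nu> where "\<nu> = real n / real k"
  define \<mu> where "\<mu> = log 2 \<nu>"
  have k: "0 < real k" and t: "1 \<le> real t" using assms by auto
  have lk: "1 \<le> log 2 (2 * real k)"
    using \<open>0 < k\<close> by (simp add: le_log_iff)
  have \<nu>1: "2 ^ 13 * log 2 (2 * real k) \<le> \<nu>"
    using n1 k unfolding \<nu>_def by (simp add: field_simps)
  then have "2 ^ 13 \<le> \<nu>" using lk by simp
  then have "13 \<le> \<mu>"
    unfolding \<mu>_def by (subst le_log_iff) (auto simp: powr_numeral)
  have \<nu>2: "2 ^ 19 * real t * \<mu>\<^sup>2 \<le> \<nu>"
    using n2 k unfolding \<mu>_def \<nu>_def by (simp add: field_simps)
  have "13 * 13 \<le> \<mu> * \<mu>"
    using \<open>13 \<le> \<mu>\<close> by (intro mult_mono) auto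
  moreover have "1 * \<mu>\<^sup>2 \<le> real t * \<mu>\<^sup>2"
    using t by (intro mult_right_mono) auto
  ultimately have "2 ^ 26 \<le> \<nu>" using \<nu>2 by (simp add: power2_eq_square)
  have e: "e = \<nu> / (2 ^ 20 * \<mu>)"
    unfolding e_def \<nu>_def[symmetric] \<mu>_def[symmetric] by (simp add: powr_minus \<nu>_def field_simps)
  have "real t * \<mu> \<le> 2 * e"
    using \<nu>2 \<open>13 \<le> \<mu>\<close> unfolding e by (simp add: field_simps power2_eq_square)
  moreover have "1 * 13 \<le> real t * \<mu>"
    using \<open>13 \<le> \<mu>\<close> t by (intro mult_mono) auto
  ultimately have e_ge: "13 \<le> 2 * e" by linarith
  have "e * 13 \<le> e * \<mu>"
    using \<open>13 \<le> \<mu>\<close> e_ge by (intro mult_left_mono) auto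
  also have "e * \<mu> = \<nu> / 2 ^ 20"
    using \<open>13 \<le> \<mu>\<close> unfolding e by simp
  finally have e_le: "13 * 2 ^ 20 * e \<le> \<nu>"
    by simp
  \<comment> \<open>The summand 3 provides the factor 8 in the later comparison of
    \<open>8 * E ^ 3\<close> with \<open>2 ^ card B\<close>.\<close>
  define q where "q = nat \<lceil>3 * e\<rceil> + 3"
  have q: "3 * e + 3 \<le> real q" "real q \<le> 3 * e + 4"
    using e_ge unfolding q_def by linarith+
  have q_le: "2 ^ 21 * real q \<le> \<nu>"
    using q e_le e_ge by simp
  \<comment> \<open>The least \<open>l\<close> with \<open>k < 2 ^ l\<close>, which is the number of
    rounds in the spread lemma.\<close>
  define l where "l = nat \<lfloor>log 2 (real k)\<rfloor> + 1"
  have "0 \<le> log 2 (real k)" using \<open>0 < k\<close> by simp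
  then have l: "log 2 (real k) < real l" "real l \<le> log 2 (real k) + 1"
    unfolding l_def by linarith+
  have "log 2 (2 * real k) = log 2 (real k) + 1"
    using k by (simp add: log_mult)
  then have l2: "2 ^ 13 * real l \<le> \<nu>" using l(2) \<nu>1 by simp
  have "real k < 2 powr real l"
    using l(1) k by (simp add: log_less_iff)
  then have "real k < real (2 ^ l)"
    by (simp add: powr_realpow)
  then have kl: "k < 2 ^ l" unfolding of_nat_less_iff .
  \<comment> \<open>Thus \<open>r * k = n - 2 * k\<close>: one \<open>k\<close> is lost in the
    exchange argument, the other pays for deleting up to \<open>k\<close> points.\<close>
  define r where "r = \<nu> - 2"
  have r_le: "\<nu> \<le> 2 * r" "0 \<le> r" "r \<le> \<nu>" "0 < \<nu>"
    using \<open>2 ^ 26 \<le> \<nu>\<close> unfolding r_def by auto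
  have "\<nu> ^ t = (2 powr \<mu>) ^ t"
    unfolding \<mu>_def using r_le by simp
  also have "\<dots> = 2 powr (real t * \<mu>)"
    by (simp add: powr_power mult.commute)
  also have "\<dots> \<le> 2 powr (2 * e)"
    using \<open>real t * \<mu> \<le> 2 * e\<close> by simp
  also have "\<dots> = (2 powr e)\<^sup>2"
    by (simp add: powr_power mult.commute)
  finally have "r ^ t \<le> (2 powr e)\<^sup>2"
    using power_mono[OF r_le(3,2), of t] by linarith
  moreover have "t \<le> q"
  proof -
    have "real t * 1 \<le> real t * \<mu>" using \<open>13 \<le> \<mu>\<close> by (intro mult_left_mono) auto
    then have "real t \<le> real q" using \<open>real t * \<mu> \<le> 2 * e\<close> q(1) e_ge by linarith
    then show ?thesis by simp
  qed
  moreover have "7 \<le> q"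
    using q(1) e_ge by linarith
  moreover have "r * real k \<le> real n - 2 * real k"
    unfolding r_def \<nu>_def using k by (simp add: field_simps)
  moreover have "32 * real l \<le> r / 4" "2 * real q \<le> r / 4" "16 * (real q + 1) \<le> r / 100" "1600 \<le> r"
    using r_le l2 q_le \<open>2 ^ 26 \<le> \<nu>\<close> by simp_all
  ultimately show ?thesis
    using that[of l r q] kl q(1) e_ge unfolding l_def by auto
qed

lemma card_link: "card (link \<A> T) = card (star \<A> T)"
proof -
  have "link \<A> T = (\<lambda>F. F - T) ` star \<A> T"
    unfolding link_def star_def by auto
  moreover have "inj_on (\<lambda>F. F - T) (star \<A> T)"
    unfolding star_def by (intro inj_onI) blast
  ultimately show ?thesis by (simp add: card_image)
qed

section \<open>Stability of large families\<close>

lemma t_intersecting_stability: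
  fixes r e L :: real
  assumes V: "finite V" "\<C> \<subseteq> Pow V" and C: "deep n \<C>" "0 < k"
    and F: "\<F> \<subseteq> layer \<C> k" "t_intersecting t \<F>"
    and L: "\<And>T. T \<subseteq> V \<Longrightarrow> card T = t \<Longrightarrow> card (star (layer \<C> k) T) \<le> L" "0 \<le> L"
    and par: "k < 2 ^ l" "0 < l" "32 * real l \<le> r / 4" "2 * real q \<le> r / 4" "16 * (real q + 1) \<le> r / 100"
    "1600 \<le> r" "r * real k \<le> real n - 2 * real k" "t \<le> q" "7 \<le> q" "r ^ t \<le> (2 powr e)\<^sup>2" "3 * e + 3 \<le> real q" "0 \<le> e"
    and large: "0.6 * L < card \<F>"
  shows "\<exists>T\<subseteq>V. card T = t \<and> card \<F> \<le> L - card (\<F> - star (layer \<C> k) T) * 2 powr e"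
proof -
  define \<A> where "\<A> = layer \<C> k"
  \<comment> \<open>The factor 4 between the spreadness of the complex and the one asked of
    subfamilies of \<open>\<F>\<close> becomes \<open>(1 / 4) ^ card B\<close> in
    \<open>core\<close>, which makes large cores negligible.\<close>
  define R where "R = r / 4"
  have R: "0 < R" "0 \<le> R" "R \<le> r" "32 * real l \<le> R" "2 * real q \<le> R" "2 * real t \<le> R"
    using par unfolding R_def by auto
  have \<A>: "F \<subseteq> V" "finite F" "card F = k" "F \<in> \<C>" if "F \<in> \<A>" for F
    using that V(2) unfolding \<A>_def layer_def by auto
  have "\<A> \<subseteq> Pow V" using \<A> by auto
  then have fin: "finite \<A>" "finite \<F>"
    using V(1) F(1) unfolding \<A>_def[symmetric] by (meson finite_Pow_iff finite_subset)+
  have F\<A>: "\<F> \<subseteq> \<A>" using F(1) unfolding \<A>_def .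
  have finV: "finite B" if "B \<subseteq> V" for B
    using that V(1) by (rule finite_subset)
  have weight: "r ^ (card B - t) * card (star \<A> B) \<le> L" if B: "B \<subseteq> V" "t \<le> card B" for B
  proof -
    obtain T where T: "T \<subseteq> B" "card T = t"
      using obtain_subset_with_card_n[OF B(2)] by auto
    have "spread_over r (card (star \<A> T)) T (star \<A> T)"
      unfolding \<A>_def using par by (intro spread_over_layer[OF V C]) auto
    from spread_overD[OF this T(1)]
    have "r ^ card (B - T) * card (star \<A> B) \<le> card (star \<A> T)"
      by (simp add: star_star[OF T(1)])
    moreover have "card (B - T) = card B - t"
      using T finV B finite_subset[OF T(1)] by (simp add: card_Diff_subset)
    moreover have "card (star \<A> T) \<le> L"
      using L(1)[of T] T B unfolding \<A>_def by auto
    ultimately show ?thesis by simp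
  qed
  define S where "S = {B. card B \<le> q \<and> (\<exists>G\<subseteq>\<F>. G \<noteq> {} \<and> (\<forall>F\<in>G. B \<subseteq> F) \<and> spread_over R (card G) B G)}"
  have SV: "S \<subseteq> Pow V"
    using F\<A> \<A>(1) unfolding S_def by blast
  have int: "t_intersecting t S"
    unfolding t_intersecting_def
  proof (intro ballI)
    fix B1 B2 assume B: "B1 \<in> S" "B2 \<in> S"
    obtain G1 where G1: "G1 \<subseteq> \<F>" "G1 \<noteq> {}" "\<And>F. F \<in> G1 \<Longrightarrow> B1 \<subseteq> F" "spread_over R (card G1) B1 G1"
      using B(1) unfolding S_def by auto
    obtain G2 where G2: "G2 \<subseteq> \<F>" "G2 \<noteq> {}" "\<And>F. F \<in> G2 \<Longrightarrow> B2 \<subseteq> F" "spread_over R (card G2) B2 G2"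
      using B(2) unfolding S_def by auto
    have "card B1 \<le> q" "card B2 \<le> q"
      using B unfolding S_def by auto
    then have "2 * real (card B1) \<le> R" "2 * real (card B2) \<le> R"
      using R(5) by linarith+
    moreover have "G1 \<subseteq> Pow V" "G2 \<subseteq> Pow V" "\<And>F. F \<in> G1 \<union> G2 \<Longrightarrow> card F \<le> k"
      using G1(1) G2(1) F\<A> \<A>(1,3) by blast+
    ultimately obtain F1 F2 where F12: "F1 \<in> G1" "F2 \<in> G2" "F1 \<inter> F2 \<subseteq> B1 \<inter> B2"
      using spread_over_cross[OF V(1) _ _ G1(2) G2(2) G1(3) G2(3) _ par(1,2) G1(4) G2(4) _ _ R(4)]
      by metis
    have "t \<le> card (F1 \<inter> F2)"
      using F(2) F12 G1(1) G2(1) unfolding t_intersecting_def by auto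
    also have "\<dots> \<le> card (B1 \<inter> B2)"
      using F12(3) SV B finV by (intro card_mono) auto
    finally show "t \<le> card (B1 \<inter> B2)" .
  qed
  \<comment> \<open>Since \<open>H\<close> avoids the stars over \<open>S\<close>, its spread core
    has more than \<open>q\<close> elements. Comparing \<open>R ^ card B\<close> with the exponent
    \<open>card B - t\<close> in \<open>weight\<close> leaves \<open>r ^ t\<close>, at most
    \<open>(2 powr e)\<^sup>2\<close>.\<close>
  have core: "\<exists>B. star H B \<noteq> {} \<and> spread_over R (card (star H B)) B (star H B) \<and> q < card B \<and>
      card H \<le> (1 / 4) ^ card B * (2 powr e)\<^sup>2 * L"
    if H: "H \<subseteq> \<F>" "H \<noteq> {}" and avoid: "\<And>B. B \<in> S \<Longrightarrow> star H B = {}" for H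
  proof -
    have finH: "finite H" using H(1) fin(2) by (rule finite_subset)
    have finF: "\<And>F. F \<in> H \<Longrightarrow> finite F"
      using H(1) F\<A> \<A>(2) by blast
    obtain B where B: "star H B \<noteq> {}" "card H \<le> R ^ card (B - {}) * card (star H B)"
      "spread_over R (card (star H B)) B (star H B)"
      using spread_core[OF finH H(2) finF empty_subsetI R(1)] by metis
    have "B \<subseteq> V"
      using B(1) H(1) F\<A> \<A>(1) unfolding star_def by blast
    have "B \<notin> S" using B(1) avoid by auto
    moreover have "star H B \<subseteq> \<F>" "\<forall>F\<in>star H B. B \<subseteq> F"
      using H(1) unfolding star_def by auto
    then have "B \<in> S" if "card B \<le> q"
      using that B(1,3) unfolding S_def by (intro CollectI conjI exI[of _ "star H B"]) auto
    ultimately have b: "q < card B"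
      by linarith
    have "card H \<le> R ^ card B * card (star H B)"
      using B(2) by simp
    also have "\<dots> \<le> R ^ card B * card (star \<A> B)"
      using R(1) card_star_mono[OF fin(1), of H B] H(1) F\<A> by (intro mult_left_mono) auto
    also have "R ^ card B = (1 / 4) ^ card B * r ^ t * r ^ (card B - t)"
    proof -
      have "R = 1 / 4 * r" unfolding R_def by simp
      then have "R ^ card B = (1 / 4) ^ card B * r ^ card B"
        by (simp only: power_mult_distrib)
      also have "card B = t + (card B - t)" using b par(8) by simp
      then have "r ^ card B = r ^ t * r ^ (card B - t)" by (metis power_add)
      finally show ?thesis by (simp only: mult.assoc)
    qed
    also have "(1 / 4) ^ card B * r ^ t * r ^ (card B - t) * card (star \<A> B)
        = (1 / 4) ^ card B * r ^ t * (r ^ (card B - t) * card (star \<A> B))"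
      by (simp only: mult.assoc)
    also have "\<dots> \<le> (1 / 4) ^ card B * (2 powr e)\<^sup>2 * L"
      using par b weight[OF \<open>B \<subseteq> V\<close>] by (intro mult_mono mult_left_mono) auto
    finally show ?thesis
      using B b by blast
  qed
  have two_le: "2 powr x \<le> 2 ^ b" if "x \<le> real b" for x :: real and b :: nat
    using that by (simp add: powr_realpow[symmetric])
  define \<F>' where "\<F>' = \<F> - (\<Union>B\<in>S. star \<A> B)"
  have rest: "card \<F>' \<le> 1 / 100 * L"
  proof (cases "\<F>' = {}")
    case False
    have sub: "\<F>' \<subseteq> \<F>"
      unfolding \<F>'_def by auto
    have avoid: "star \<F>' B = {}" if "B \<in> S" for B
      using that F\<A> unfolding \<F>'_def star_def by blast
    obtain B where B: "star \<F>' B \<noteq> {}" "q < card B" "card \<F>' \<le> (1 / 4) ^ card B * (2 powr e)\<^sup>2 * L"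
      using core[OF sub False] avoid by blast
    have "(2 powr e)\<^sup>2 = 2 powr (2 * e)"
      by (simp add: powr_power mult.commute)
    also have "\<dots> \<le> 2 ^ card B"
      using par B(2) by (intro two_le) linarith
    finally have "(1 / 4) ^ card B * (2 powr e)\<^sup>2 \<le> (1 / 4) ^ card B * 2 ^ card B"
      by (intro mult_left_mono) auto
    also have "\<dots> = (1 / 2) ^ card B"
      unfolding power_mult_distrib[symmetric] by simp
    also have "\<dots> \<le> (1 / 2) ^ 7"
      using B(2) par by (intro power_decreasing) auto
    also have "\<dots> \<le> 1 / 100" by (simp add: power_divide)
    finally have "(1 / 4) ^ card B * (2 powr e)\<^sup>2 * L \<le> 1 / 100 * L"
      using L(2) by (intro mult_right_mono)
    then show ?thesis using B(3) by linarith
  qed (use L in simp)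
  have "16 * (real q + 1) \<le> r" "16 * (real q + 1) / r \<le> 1 / 100"
    using par by (auto simp: field_simps)
  obtain T where T: "T \<subseteq> V" "card T = t" "\<And>B. B \<in> S \<Longrightarrow> T \<subseteq> B"
  proof -
    \<comment> \<open>Otherwise the covered and the uncovered part of \<open>\<F>\<close> have at
      most \<open>L / 100\<close> members each, against \<open>0.6 * L < card \<F>\<close>.\<close>
    have "\<not> card (\<Union>B\<in>S. star \<A> B) \<le> 16 * (real q + 1) / r * L"
    proof
      assume "card (\<Union>B\<in>S. star \<A> B) \<le> 16 * (real q + 1) / r * L"
      also have "\<dots> \<le> 1 / 100 * L"
        using \<open>16 * (real q + 1) / r \<le> 1 / 100\<close> L(2) by (intro mult_right_mono)
      finally have "card (\<Union>B\<in>S. star \<A> B) \<le> 1 / 100 * L" .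
      moreover have "card \<F> \<le> card (\<F>' \<union> (\<Union>B\<in>S. star \<A> B))"
        using fin F\<A> unfolding \<F>'_def
        by (intro card_mono finite_UnI) (auto intro: finite_subset[of _ \<A>] simp: star_def)
      then have "card \<F> \<le> card \<F>' + card (\<Union>B\<in>S. star \<A> B)"
        using card_Un_le[of \<F>' "\<Union>B\<in>S. star \<A> B"] by linarith
      ultimately show False using rest large L(2) by simp
    qed
    then show ?thesis
      using t_intersecting_cover[OF V(1) \<open>\<A> \<subseteq> Pow V\<close> SV _ int weight \<open>16 * (real q + 1) \<le> r\<close> L(2)] that
      unfolding S_def by blast
  qed
  have finT: "finite T" using T(1) finV by auto
  define H where "H = \<F> - star \<A> T"
  have starT: "card (star \<A> T) \<le> L"
    using L(1)[OF T(1,2)] unfolding \<A>_def .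
  have split: "card \<F> = card (star \<F> T) + card H"
  proof -
    have "\<F> = star \<F> T \<union> H" "star \<F> T \<inter> H = {}"
      using F\<A> unfolding H_def star_def by auto
    then show ?thesis
      using fin(2) by (metis card_Un_disjoint finite_Un)
  qed
  have "card \<F> \<le> L - card H * 2 powr e"
  proof (cases "H = {}")
    case True
    then show ?thesis
      using split card_star_mono[OF fin(1) F\<A>, of T] starT by simp
  next
    case False
    have sub: "H \<subseteq> \<F>"
      unfolding H_def by auto
    have avoid: "star H B = {}" if "B \<in> S" for B
      using T(3)[OF that] F\<A> unfolding H_def star_def by blast
    obtain B where B: "star H B \<noteq> {}" "spread_over R (card (star H B)) B (star H B)" "q < card B"
      "card H \<le> (1 / 4) ^ card B * (2 powr e)\<^sup>2 * L"
      using core[OF sub False] avoid by blast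
    obtain F0 where F0: "F0 \<in> H" "B \<subseteq> F0" "F0 \<in> \<A>" "\<not> T \<subseteq> F0"
      using B(1) F\<A> unfolding H_def star_def by auto
    have "\<not> T \<subseteq> B" using F0 by auto
    define Y where "Y = B - T"
    have finB: "finite B" using F0 \<A>(2) finite_subset by auto
    have Y: "finite Y" "Y \<inter> T = {}" "card Y \<le> card B"
      using finB card_mono[of B Y] unfolding Y_def by auto
    have "card B \<le> k"
      using F0 \<A>[of F0] card_mono[of F0 B] by auto
    then have rY: "r * real k \<le> real n - real (card Y) - real k"
      using par(7) Y(3) by linarith
    define \<D> where "\<D> = {F\<in>\<C>. F \<inter> Y = {}}"
    \<comment> \<open>The members of the star of \<open>T\<close> that avoid \<open>B - T\<close>.
      Passing to the subcomplex \<open>\<D>\<close> shows that this family is still spread around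
      \<open>T\<close> and not too small.\<close>
    define \<A>' where "\<A>' = star (layer \<D> k) T"
    have \<A>'_iff: "F \<in> \<A>' \<longleftrightarrow> F \<in> \<A> \<and> T \<subseteq> F \<and> F \<inter> Y = {}" for F
      unfolding \<A>'_def \<D>_def \<A>_def star_def layer_def by auto
    have \<A>'_sub: "\<A>' \<subseteq> star \<A> T"
      using \<A>'_iff unfolding star_def by auto
    have fin\<A>': "finite \<A>'"
      using \<A>'_sub finite_star[OF fin(1)] by (rule finite_subset)
    have "(1 - 1 / r) ^ card Y * card (star \<A> T) \<le> card \<A>'"
      unfolding \<A>'_def \<D>_def \<A>_def using par by (intro card_star_avoiding[OF V C _ Y(1,2) rY]) auto
    moreover have "(1 / 2) ^ card B \<le> (1 - 1 / r) ^ card Y"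
    proof -
      have "(1 / 2 :: real) ^ card B \<le> (1 / 2) ^ card Y"
        using Y(3) by (intro power_decreasing) auto
      also have "\<dots> \<le> (1 - 1 / r) ^ card Y"
        using par(6) by (intro power_mono) (auto simp: field_simps)
      finally show ?thesis .
    qed
    ultimately have \<A>'_ge: "(1 / 2) ^ card B * card (star \<A> T) \<le> card \<A>'"
      using mult_right_mono[of "(1 / 2) ^ card B" "(1 - 1 / r) ^ card Y" "real (card (star \<A> T))"] by linarith
    have "card \<F> \<le> card (star \<A> T) + card \<F>'"
    proof -
      have "\<F> \<subseteq> star \<A> T \<union> \<F>'"
        using T(3) F\<A> unfolding \<F>'_def star_def by blast
      then have "card \<F> \<le> card (star \<A> T \<union> \<F>')"
        using fin finite_star[OF fin(1)] unfolding \<F>'_def by (intro card_mono) auto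
      then show ?thesis using card_Un_le[of "star \<A> T" \<F>'] by linarith
    qed
    then have starT_ge: "1 / 2 * L < card (star \<A> T)"
      using rest large L(2) by simp
    then have "0 < (1 / 2) ^ card B * real (card (star \<A> T))"
      using L(2) by simp
    then have \<A>'_pos: "0 < real (card \<A>')"
      using \<A>'_ge by linarith
    have deep\<D>: "deep (n - card Y) \<D>" "\<D> \<subseteq> Pow V"
      using deep_avoiding[OF C(1) Y(1)] V(2) unfolding \<D>_def by auto
    have spread\<A>': "spread_over r (card \<A>') T \<A>'"
      unfolding \<A>'_def using par rY by (intro spread_over_layer[OF V(1) deep\<D>(2,1) C(2)]) auto
    \<comment> \<open>If \<open>\<F>\<close> contained half of \<open>\<A>'\<close>, these members
      and those of \<open>star H B\<close> avoiding \<open>T - B\<close> could be separated outside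
      \<open>T\<close> and \<open>B\<close>. Two members of \<open>\<F>\<close> would then meet only
      inside \<open>T \<inter> B\<close>, which has fewer than \<open>t\<close> points.\<close>
    have half: "2 * real (card (\<F> \<inter> \<A>')) < card \<A>'"
    proof (rule ccontr)
      assume "\<not> 2 * real (card (\<F> \<inter> \<A>')) < card \<A>'"
      then have le1: "real (card \<A>') \<le> 2 * real (card (\<F> \<inter> \<A>'))" by simp
      define G where "G = {F\<in>star H B. F \<inter> (T - B) = {}}"
      have finH: "finite (star H B)"
        using fin(2) unfolding H_def by (intro finite_star) auto
      have "card (star H B) \<le> 2 * card G"
        unfolding G_def using B(2) finT finH R(6) T(2)
        by (intro card_not_hitting[of _ _ _ R]) (auto simp: star_def)
      then have le2: "real (card (star H B)) \<le> 2 * real (card G)" by linarith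
      have pos2: "0 < real (card (star H B))"
        using B(1) finH by (simp add: card_gt_0_iff)
      have s1: "spread_over R (card \<A>') T (\<F> \<inter> \<A>')"
        using spread_over_mono[OF spread\<A>' fin\<A>' _ R(2,3)] by auto
      have s2: "spread_over R (card (star H B)) B G"
        using spread_over_mono[OF B(2) finH _ R(2) order_refl] unfolding G_def by auto
      have G\<F>: "G \<subseteq> \<F>" unfolding G_def H_def star_def by auto
      have "\<exists>F1\<in>\<F> \<inter> \<A>'. \<exists>F2\<in>G. (F1 - T) \<inter> (F2 - B) = {}"
      proof (rule spread_over_disjoint[OF V(1) _ _ _ _ _ par(1,2) s1 \<A>'_pos le1 s2 pos2 le2 R(4)])
        show "\<F> \<inter> \<A>' \<subseteq> Pow V" "G \<subseteq> Pow V"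
          using F\<A> G\<F> \<open>\<A> \<subseteq> Pow V\<close> by auto
        show "card F \<le> k" if "F \<in> \<F> \<inter> \<A>' \<union> G" for F
          using that F\<A> G\<F> \<A>(3) by fastforce
      qed (auto simp: \<A>'_iff G_def star_def)
      then obtain F1 F2 where F12: "F1 \<in> \<F>" "F1 \<in> \<A>'" "F2 \<in> G" "(F1 - T) \<inter> (F2 - B) = {}"
        by blast
      have "F1 \<inter> (B - T) = {}" "F2 \<inter> (T - B) = {}"
        using F12(2,3) unfolding \<A>'_iff Y_def G_def by auto
      then have "F1 \<inter> F2 \<subseteq> T \<inter> B"
        using F12(4) by blast
      have "t \<le> card (F1 \<inter> F2)"
        using F(2) F12 G\<F> unfolding t_intersecting_def by blast
      also have "\<dots> \<le> card (T \<inter> B)"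
        using \<open>F1 \<inter> F2 \<subseteq> T \<inter> B\<close> finT by (intro card_mono) auto
      finally have "T \<inter> B = T"
        using finT T(2) by (intro card_seteq) auto
      then show False using \<open>\<not> T \<subseteq> B\<close> by auto
    qed
    have "card \<A>' = card (\<F> \<inter> \<A>') + card (\<A>' - \<F>)"
      using fin\<A>' card_Int_Diff[of \<A>' \<F>] by (simp add: Int_commute)
    moreover have "card (star \<F> T \<union> (\<A>' - \<F>)) \<le> card (star \<A> T)"
      using \<A>'_sub star_mono[OF F\<A>, of T] by (intro card_mono finite_star fin) auto
    moreover have "card (star \<F> T \<union> (\<A>' - \<F>)) = card (star \<F> T) + card (\<A>' - \<F>)"
      using fin(2) fin\<A>' star_subset[of \<F> T] by (intro card_Un_disjoint) (auto intro: finite_star)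
    \<comment> \<open>More than half of \<open>\<A>'\<close> is missing from \<open>\<F>\<close>,
      and all of it lies in the star of \<open>T\<close>.\<close>
    ultimately have upper: "real (card (star \<F> T)) + 1 / 2 * card \<A>' \<le> L"
      using half starT by linarith
    define E where "E = 2 powr e"
    have "1 \<le> E" unfolding E_def using par(12) by (simp add: ge_one_powr_ge_zero)
    have "8 * E ^ 3 = 2 powr (3 * e + 3)"
      unfolding E_def by (simp add: powr_add powr_power mult.commute powr_numeral)
    also have "\<dots> \<le> 2 ^ card B"
      using par(11) B(3) by (intro two_le) linarith
    finally have E3: "8 * E ^ 3 \<le> 2 ^ card B" .
    \<comment> \<open>In the factor \<open>1 + E\<close>, the 1 accounts for \<open>H\<close> as a
      part of \<open>\<F>\<close> and \<open>E\<close> for the claimed gain. It is bounded by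
      \<open>2 * E\<close>, so \<open>E\<close> occurs to the third power.\<close>
    have "real (card H) * (1 + E) \<le> ((1 / 4) ^ card B * E\<^sup>2 * L) * (2 * E)"
      using B(4) \<open>1 \<le> E\<close> unfolding E_def[symmetric] by (intro mult_mono) auto
    also have "\<dots> = 1 / 4 * ((1 / 4) ^ card B * (8 * E ^ 3)) * L"
      by (simp add: power2_eq_square power3_eq_cube)
    also have "\<dots> \<le> 1 / 4 * ((1 / 4) ^ card B * 2 ^ card B) * L"
      using E3 L(2) by (intro mult_right_mono mult_left_mono) auto
    also have "(1 / 4 :: real) ^ card B * 2 ^ card B = (1 / 2) ^ card B"
      unfolding power_mult_distrib[symmetric] by simp
    finally have "real (card H) * (1 + E) \<le> 1 / 4 * (1 / 2) ^ card B * L" .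
    also have "\<dots> = 1 / 2 * ((1 / 2) ^ card B * (1 / 2 * L))"
      by simp
    also have "\<dots> \<le> 1 / 2 * ((1 / 2) ^ card B * card (star \<A> T))"
      using starT_ge by (intro mult_left_mono) auto
    also have "\<dots> \<le> 1 / 2 * card \<A>'"
      using \<A>'_ge by (intro mult_left_mono) auto
    finally have "real (card H) + real (card H) * E \<le> 1 / 2 * card \<A>'"
      by (simp add: algebra_simps)
    then show ?thesis
      using upper split unfolding E_def by simp
  qed
  then show ?thesis
    using T unfolding H_def \<A>_def by blast
qed

theorem theorem1:
  fixes N n k t :: nat and \<C> \<F> :: "nat set set"
  assumes "N > 0" and "n > 0" and "k > 0" and "t > 0"
    and "t \<le> N"
    and "real n \<ge> 2 ^ 13 * real k * log 2 (2 * real k)"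
    and "real n \<ge> 2 ^ 19 * real t * real k * (log 2 (real n / real k))\<^sup>2"
    and "\<C> \<subseteq> Pow {1..N}"
    and "hereditary \<C>"
    and "\<And>M. inclusion_maximal \<C> M \<Longrightarrow> n \<le> card M"
    and "\<F> \<subseteq> layer \<C> k"
    and "t_intersecting t \<F>"
  shows "(\<exists>T \<in> nsets {1..N} t. card \<F> \<le> card (link (layer \<C> k) T)) \<and>
    (let m = Min ((\<lambda>T. card (\<F> - star (layer \<C> k) T)) ` nsets {1..N} t);
         L = Max ((\<lambda>T. card (link (layer \<C> k) T)) ` nsets {1..N} t)
     in real (card \<F>) \<le>
          max (real L - real m * 2 powr (2 powr (-20) * (real n / (real k * log 2 (real n / real k)))))
              (0.6 * real L))"
proof -
  define e where "e = 2 powr (-20) * (real n / (real k * log 2 (real n / real k)))"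
  define m where "m = Min ((\<lambda>T. card (\<F> - star (layer \<C> k) T)) ` nsets {1..N} t)"
  define L where "L = Max ((\<lambda>T. card (link (layer \<C> k) T)) ` nsets {1..N} t)"
  have sets: "finite (nsets {1..N} t)" "nsets {1..N} t \<noteq> {}"
    using \<open>t \<le> N\<close> by (auto simp: finite_imp_finite_nsets nsets_eq_empty_iff)
  have nsets: "T \<in> nsets {1..N} t \<longleftrightarrow> T \<subseteq> {1..N} \<and> card T = t" for T
    unfolding nsets_def by (auto intro: finite_subset)
  have "finite \<C>"
    using assms(8) by (rule finite_subset) simp
  have deep: "deep n \<C>"
    using deep_if_maximal[OF \<open>finite \<C>\<close> assms(9,10)] .
  have L: "card (star (layer \<C> k) T) \<le> L" if "T \<in> nsets {1..N} t" for T
    unfolding L_def card_link using that sets by (intro Max_ge) auto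
  have bound: "real (card \<F>) \<le> max (real L - real m * 2 powr e) (0.6 * real L)"
  proof (cases "0.6 * real L < card \<F>")
    case True
    obtain q l :: nat and r :: real where par:
      "k < 2 ^ l" "0 < l" "32 * real l \<le> r / 4" "2 * real q \<le> r / 4" "16 * (real q + 1) \<le> r / 100"
      "1600 \<le> r" "r * real k \<le> real n - 2 * real k" "t \<le> q" "7 \<le> q" "r ^ t \<le> (2 powr e)\<^sup>2" "3 * e + 3 \<le> real q" "0 \<le> e"
      using spread_parameters[OF \<open>k > 0\<close> \<open>t > 0\<close> assms(6,7)] unfolding e_def by metis
    obtain T where T: "T \<subseteq> {1..N}" "card T = t"
      "card \<F> \<le> real L - card (\<F> - star (layer \<C> k) T) * 2 powr e"
      using t_intersecting_stability[OF finite_atLeastAtMost assms(8) deep \<open>k > 0\<close> assms(11,12) _ _ par True] L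
      unfolding nsets by auto
    \<comment> \<open>The set \<open>T\<close> found here need not attain the minimum; any
      \<open>T\<close> gives an upper bound for \<open>m\<close>.\<close>
    have "m \<le> card (\<F> - star (layer \<C> k) T)"
      unfolding m_def using T sets nsets by (intro Min_le) auto
    then have "real m * 2 powr e \<le> card (\<F> - star (layer \<C> k) T) * 2 powr e"
      by (intro mult_right_mono) auto
    then show ?thesis using T(3) by linarith
  qed simp
  \<comment> \<open>Both entries of the maximum are at most \<open>L\<close>, so the first claim
    follows from the second with \<open>T\<close> attaining \<open>L\<close>.\<close>
  also have "\<dots> \<le> real L"
    by simp
  finally have "card \<F> \<le> L" by simp
  moreover have "L \<in> (\<lambda>T. card (link (layer \<C> k) T)) ` nsets {1..N} t"
    unfolding L_def using sets by (intro Max_in) auto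
  ultimately have "\<exists>T \<in> nsets {1..N} t. card \<F> \<le> card (link (layer \<C> k) T)"
    by auto
  then show ?thesis
    using bound unfolding Let_def L_def m_def e_def by blast
qed

end
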